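(* Consider the generalized Riemann problem for the 1D ten-moment equations with source, nonsonic case, and assume that the 6-shock wave associated with $u_1+c$ moves to the right. Then, with the coefficients defined in the context, $$\left(\tfrac{\mathcal D u_2}{\mathcal D t}\right)_{\ast R}=\frac{d_{3,R}b_{4,R}-d_{4,R}b_{3,R}}{a_{3,R}b_{4,R}-a_{4,R}b_{3,R}},\qquad\left(\tfrac{\mathcal D p_{12}}{\mathcal D t}\right)_{\ast R}=\frac{d_{3,R}a_{4,R}-d_{4,R}a_{3,R}}{b_{3,R}a_{4,R}-b_{4,R}a_{3,R}}.$$ It follows that $$\left(\tfrac{\partial u_2}{\partial t}\right)_{\ast R}=\left(\tfrac{\mathcal D u_2}{\mathcal D t}\right)_{\ast R}+\frac{u_{1,\ast}}{p_{11,\ast}}\left[\left(\tfrac{\mathcal D p_{12}}{\mathcal D t}\right)_{\ast R}-\frac{2p_{12,\ast R}}{3p_{11,\ast}}\left(\tfrac{\mathcal D p_{11}}{\mathcal D t}\right)_\ast\right],\quad \left(\tfrac{\partial p_{12}}{\partial t}\right)_{\ast R}=\left(\tfrac{\mathcal D p_{12}}{\mathcal D t}\right)_{\ast R}+\rho_{\ast R}u_{1,\ast}\left(\tfrac{\mathcal D u_2}{\mathcal D t}\right)_{\ast R}.$$ Moreover $\left(\frac{\partial p_{22}}{\partial t}\right)_{\ast R}$ is computed by $g_{p_{22}}^{\ast R}\left(\frac{\partial p_{22}}{\partial t}\right)_{\ast R}=f_{p_{22}}^{\ast R}$, where $g_{p_{22}}^{\ast R}=\frac12(u_{1,\ast}-\sigma_R)^2$,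 $$f_{p_{22}}^{\ast R}=u_{1,\ast}\widetilde f_{p_{22}}^{\ast R}-\frac{(p_{11,\ast}p_{22,\ast R}-4p_{12,\ast R}^2)(u_{1,\ast}-\sigma_R)\sigma_R}{6p_{11,\ast}^2}\left(\tfrac{\mathcal D p_{11}}{\mathcal D t}\right)_\ast-\frac{p_{12,\ast R}\sigma_R(u_{1,\ast}-\sigma_R)}{p_{11,\ast}}\left(\tfrac{\mathcal D p_{12}}{\mathcal D t}\right)_{\ast R},$$ $$\widetilde f_{p_{22}}^{\ast R}=\tfrac{\mathcal D_{\sigma_R}\Gamma_{E_{22,R}}}{\mathcal D t}+E_{22,\ast R}\tfrac{\mathcal D_{\sigma_R}\sigma_R}{\mathcal D t}-\tfrac12u_{2,\ast R}^2(u_{1,\ast}-\sigma_R)\left(\tfrac{\mathcal D_{\sigma_R}\rho}{\mathcal D t}\right)_{\ast R}-E_{22,\ast R}\left(\tfrac{\mathcal D_{\sigma_R}u_1}{\mathcal D t}\right)_{\ast R}-(2E_{12,\ast R}-\rho_{\ast R}u_{2,\ast R}\sigma_R)\left(\tfrac{\mathcal D_{\sigma_R}u_2}{\mathcal D t}\right)_{\ast R}-u_{2,\ast R}\left(\tfrac{\mathcal D_{\sigma_R}p_{12}}{\mathcal D t}\right)_{\ast R}.$$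
   Context: **System.** $\mathbf V=(\rho,u_1,u_2,p_{11},p_{12},p_{22})^\top$ with $\rho>0$, $p_{11}>0$, $p_{11}p_{22}-p_{12}^2>0$; $W(x)$ is a given $C^1$ potential; $c=\sqrt{3p_{11}/\rho}$; $E_{ij}=\frac12(\rho u_iu_j+p_{ij})$; $\frac{\mathcal D}{\mathcal D t}=\partial_t+u_1\partial_x$. With $\mathbf U=(\rho,\rho u_1,\rho u_2,E_{11},E_{12},E_{22})^\top$: $\partial_t\mathbf U+\partial_x\mathbf F=\mathbf S$, $\mathbf F=(\rho u_1,\rho u_1^2+p_{11},\rho u_1u_2+p_{12},(E_{11}+p_{11})u_1,E_{12}u_1+\frac12(p_{11}u_2+p_{12}u_1),E_{22}u_1+p_{12}u_2)^\top$, $\mathbf S=(0,-\frac12\rho W_x,0,-\frac12\rho u_1W_x,-\frac14\rho u_2W_x,0)^\top$. Smooth solutions satisfy: $\frac{\mathcal D\rho}{\mathcal D t}+\rho\partial_xu_1=0$; $\frac{\mathcal D u_1}{\mathcal D t}+\frac1\rho\partial_xp_{11}=-\frac12W_x$; $\frac{\mathcal D u_2}{\mathcal D t}+\frac1\rho\partial_xp_{12}=0$; $\frac{\mathcal D p_{11}}{\mathcal D t}+3p_{11}\partial_xu_1=0$; $\frac{\mathcal D p_{12}}{\mathcal D t}+2p_{12}\partial_xu_1+p_{11}\partial_xu_2=0$; $\frac{\mathcal D p_{22}}{\mathcal D t}+p_{22}\partial_xu_1+2p_{12}\partial_xu_2=0$. **Generalized Riemann problem.** Initial data $\mathbf V_L+x\mathbf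 V_L'$ for $x<0$, $\mathbf V_R+x\mathbf V_R'$ for $x>0$, with constant $\mathbf V_K=(\rho_K,u_{1,K},u_{2,K},p_{11,K},p_{12,K},p_{22,K})^\top$, $\mathbf V_K'=(\rho_K',\dots,p_{22,K}')^\top$. Near $(0,0)$, $0<t\ll1$, the solution is piecewise smooth; the rightmost wave is a smooth 6-shock curve satisfying the Rankine–Hugoniot conditions, and the region immediately to its left (to the right of the 5-shear wave of speed $u_1+c/\sqrt3$) is labelled $\ast R$. In $\ast R$ and to the right of the shock, $\mathbf V$ and its first derivatives have limits at $(0,0)$; subscript $\ast R$ denotes the limit from $\ast R$. The limiting state is $\mathbf V_{\ast R}=(\rho_{\ast R},u_{1,\ast},u_{2,\ast R},p_{11,\ast},p_{12,\ast R},p_{22,\ast R})^\top$, $E_{ij,\ast R}$, $E_{ij,R}$ are the corresponding energies; $(\frac{\mathcal D u_1}{\mathcal D t})_\ast,(\frac{\mathcal D p_{11}}{\mathcal D t})_\ast$ denote the limits there (common to all regions between the 1-wave and the 6-wave). Nonsonic: the $t$-axis lies between the 1-wave and the 6-wave. The shock satisfies $p_{11,\ast}>p_{11,R}$ and $\sigma_R=u_{1,R}+\sqrt{(2p_{11,\ast}+p_{11,R})/\rho_R}$ at the origin; along the shock $\sigma=\overline u_1+\sqrt{(2p_{11}+\overline p_{11})/\overline\rho}$, $\rho=\overline\rho\,\frac{2p_{11}+\overline p_{11}}{p_{11}+2\overline p_{11}}$ (bars: state on the right). **Derivatives along the shock** ($\frac{\mathcal D_{\sigma_R}}{\mathcal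 D t}=\partial_t+\sigma_R\partial_x$; write $\mathcal D_{\sigma_R}q$ for $\frac{\mathcal D_{\sigma_R}q}{\mathcal D t}$): $\mathcal D_{\sigma_R}\rho_R=(\sigma_R-u_{1,R})\rho_R'-\rho_Ru_{1,R}'$; $\mathcal D_{\sigma_R}u_{1,R}=(\sigma_R-u_{1,R})u_{1,R}'-\frac{p_{11,R}'}{\rho_R}-\frac12W_x(0)$; $\mathcal D_{\sigma_R}u_{2,R}=(\sigma_R-u_{1,R})u_{2,R}'-\frac{p_{12,R}'}{\rho_R}$; $\mathcal D_{\sigma_R}p_{11,R}=(\sigma_R-u_{1,R})p_{11,R}'-3p_{11,R}u_{1,R}'$; $\mathcal D_{\sigma_R}p_{12,R}=(\sigma_R-u_{1,R})p_{12,R}'-2p_{12,R}u_{1,R}'-p_{11,R}u_{2,R}'$; $\mathcal D_{\sigma_R}p_{22,R}=(\sigma_R-u_{1,R})p_{22,R}'-p_{22,R}u_{1,R}'-2p_{12,R}u_{2,R}'$; $\mathcal D_{\sigma_R}p_{11,\ast}=(\frac{\mathcal D p_{11}}{\mathcal D t})_\ast-\rho_{\ast R}(\sigma_R-u_{1,\ast})[(\frac{\mathcal D u_1}{\mathcal D t})_\ast+\frac12W_x(0)]$; $\mathcal D_{\sigma_R}\sigma_R=\mathcal D_{\sigma_R}u_{1,R}-\frac{\sqrt{2p_{11,\ast}+p_{11,R}}}{2\rho_R\sqrt{\rho_R}}\mathcal D_{\sigma_R}\rho_R+\frac{\frac12\mathcal D_{\sigma_R}p_{11,R}+\mathcal D_{\sigma_R}p_{11,\ast}}{\sqrt{\rho_R(2p_{11,\ast}+p_{11,R})}}$;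 $(\mathcal D_{\sigma_R}\rho)_{\ast R}=H_1^R\mathcal D_{\sigma_R}p_{11,\ast}+H_2^R\mathcal D_{\sigma_R}p_{11,R}+H_3^R\mathcal D_{\sigma_R}\rho_R$, $H_1^R=\frac{3\rho_Rp_{11,R}}{(p_{11,\ast}+2p_{11,R})^2}$, $H_2^R=-\frac{3\rho_Rp_{11,\ast}}{(p_{11,\ast}+2p_{11,R})^2}$, $H_3^R=\frac{2p_{11,\ast}+p_{11,R}}{p_{11,\ast}+2p_{11,R}}$; $(\mathcal D_{\sigma_R}u_1)_{\ast R}=(\frac{\partial u_1}{\partial t})_{\ast R}-\frac{\sigma_R}{3p_{11,\ast}}(\frac{\mathcal D p_{11}}{\mathcal D t})_\ast$; $(\mathcal D_{\sigma_R}u_2)_{\ast R}=(\frac{\mathcal D u_2}{\mathcal D t})_{\ast R}-\frac{\sigma_R-u_{1,\ast}}{p_{11,\ast}}[(\frac{\mathcal D p_{12}}{\mathcal D t})_{\ast R}-\frac{2p_{12,\ast R}}{3p_{11,\ast}}(\frac{\mathcal D p_{11}}{\mathcal D t})_\ast]$; $(\mathcal D_{\sigma_R}p_{12})_{\ast R}=(\frac{\mathcal D p_{12}}{\mathcal D t})_{\ast R}-\rho_{\ast R}(\sigma_R-u_{1,\ast})(\frac{\mathcal D u_2}{\mathcal D t})_{\ast R}$; $\mathcal D_{\sigma_R}\Gamma_{m_{2,R}}=u_{2,R}(u_{1,R}-\sigma_R)\mathcal D_{\sigma_R}\rho_R+\rho_Ru_{2,R}\mathcal D_{\sigma_R}u_{1,R}+\rho_R(u_{1,R}-\sigma_R)\mathcal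 D_{\sigma_R}u_{2,R}+\mathcal D_{\sigma_R}p_{12,R}-\rho_Ru_{2,R}\mathcal D_{\sigma_R}\sigma_R$; $\mathcal D_{\sigma_R}\Gamma_{E_{12,R}}=\frac12u_{1,R}u_{2,R}(u_{1,R}-\sigma_R)\mathcal D_{\sigma_R}\rho_R+(2E_{12,R}-\frac12\rho_Ru_{2,R}\sigma_R)\mathcal D_{\sigma_R}u_{1,R}+(E_{11,R}-\frac12\rho_Ru_{1,R}\sigma_R)\mathcal D_{\sigma_R}u_{2,R}+\frac12u_{2,R}\mathcal D_{\sigma_R}p_{11,R}+(u_{1,R}-\frac12\sigma_R)\mathcal D_{\sigma_R}p_{12,R}-E_{12,R}\mathcal D_{\sigma_R}\sigma_R$; $\mathcal D_{\sigma_R}\Gamma_{E_{22,R}}=\frac12u_{2,R}^2(u_{1,R}-\sigma_R)\mathcal D_{\sigma_R}\rho_R+E_{22,R}\mathcal D_{\sigma_R}u_{1,R}+(2E_{12,R}-\rho_Ru_{2,R}\sigma_R)\mathcal D_{\sigma_R}u_{2,R}+u_{2,R}\mathcal D_{\sigma_R}p_{12,R}+\frac12(u_{1,R}-\sigma_R)\mathcal D_{\sigma_R}p_{22,R}-E_{22,R}\mathcal D_{\sigma_R}\sigma_R$. **Coefficients.** $a_{3,R}=2\rho_{\ast R}(u_{1,\ast}-\sigma_R)$, $b_{3,R}=1+\frac{\rho_{\ast R}(u_{1,\ast}-\sigma_R)^2}{p_{11,\ast}}$, $d_{3,R}=\mathcal D_{\sigma_R}\Gamma_{m_{2,R}}+\rho_{\ast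 R}u_{2,\ast R}\mathcal D_{\sigma_R}\sigma_R-u_{2,\ast R}(u_{1,\ast}-\sigma_R)(\mathcal D_{\sigma_R}\rho)_{\ast R}-\rho_{\ast R}u_{2,\ast R}(\mathcal D_{\sigma_R}u_1)_{\ast R}+\frac{2\rho_{\ast R}p_{12,\ast R}(u_{1,\ast}-\sigma_R)^2}{3p_{11,\ast}^2}(\frac{\mathcal D p_{11}}{\mathcal D t})_\ast$; $a_{4,R}=E_{11,\ast R}+\rho_{\ast R}(u_{1,\ast}-\sigma_R)^2-\frac12\rho_{\ast R}\sigma_R^2$, $b_{4,R}=(E_{11,\ast R}-\frac12\rho_{\ast R}u_{1,\ast}\sigma_R)\frac{u_{1,\ast}-\sigma_R}{p_{11,\ast}}+u_{1,\ast}-\frac12\sigma_R$, $d_{4,R}=\mathcal D_{\sigma_R}\Gamma_{E_{12,R}}+E_{12,\ast R}\mathcal D_{\sigma_R}\sigma_R-\frac12u_{1,\ast}u_{2,\ast R}(u_{1,\ast}-\sigma_R)(\mathcal D_{\sigma_R}\rho)_{\ast R}-\frac12u_{2,\ast R}\mathcal D_{\sigma_R}p_{11,\ast}-(2E_{12,\ast R}-\frac12\rho_{\ast R}u_{2,\ast R}\sigma_R)(\mathcal D_{\sigma_R}u_1)_{\ast R}+(E_{11,\ast R}-\frac12\rho_{\ast R}u_{1,\ast}\sigma_R)\frac{2p_{12,\ast R}(u_{1,\ast}-\sigma_R)}{3p_{11,\ast}^2}(\frac{\mathcal D p_{11}}{\mathcal D t})_\ast$. *)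

theory Defs
  imports "HOL-Analysis.Analysis"
begin

section \<open>The one-dimensional ten-moment system\<close>

text \<open>Primitive states are vectors \<open>(\<rho>, u\<^sub>1, u\<^sub>2, p\<^sub>1\<^sub>1, p\<^sub>1\<^sub>2, p\<^sub>2\<^sub>2)\<close>.\<close>

type_synonym state = "real ^ 6"

abbreviation rho :: "state \<Rightarrow> real" where "rho v \<equiv> v $ 1"
abbreviation u1 :: "state \<Rightarrow> real" where "u1 v \<equiv> v $ 2"
abbreviation u2 :: "state \<Rightarrow> real" where "u2 v \<equiv> v $ 3"
abbreviation p11 :: "state \<Rightarrow> real" where "p11 v \<equiv> v $ 4"
abbreviation p12 :: "state \<Rightarrow> real" where "p12 v \<equiv> v $ 5"
abbreviation p22 :: "state \<Rightarrow> real" where "p22 v \<equiv> v $ 6"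

lemma vector_6 [simp]:
  "(vector [a,b,c,d,e,f] :: ('a::zero)^6) $ 1 = a"
  "(vector [a,b,c,d,e,f] :: ('a::zero)^6) $ 2 = b"
  "(vector [a,b,c,d,e,f] :: ('a::zero)^6) $ 3 = c"
  "(vector [a,b,c,d,e,f] :: ('a::zero)^6) $ 4 = d"
  "(vector [a,b,c,d,e,f] :: ('a::zero)^6) $ 5 = e"
  "(vector [a,b,c,d,e,f] :: ('a::zero)^6) $ 6 = f"
  unfolding vector_def by simp_all

definition admissible :: "state \<Rightarrow> bool" where
  "admissible v \<longleftrightarrow> rho v > 0 \<and> p11 v > 0 \<and> p11 v * p22 v - (p12 v)\<^sup>2 > 0"

definition E11 :: "state \<Rightarrow> real" where "E11 v = (rho v * u1 v * u1 v + p11 v) / 2"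
definition E12 :: "state \<Rightarrow> real" where "E12 v = (rho v * u1 v * u2 v + p12 v) / 2"
definition E22 :: "state \<Rightarrow> real" where "E22 v = (rho v * u2 v * u2 v + p22 v) / 2"

definition cons :: "state \<Rightarrow> real ^ 6" where
  "cons v = vector [rho v, rho v * u1 v, rho v * u2 v, E11 v, E12 v, E22 v]"

definition flux :: "state \<Rightarrow> real ^ 6" where
  "flux v = vector
     [rho v * u1 v,
      rho v * (u1 v)\<^sup>2 + p11 v,
      rho v * u1 v * u2 v + p12 v,
      (E11 v + p11 v) * u1 v,
      E12 v * u1 v + (p11 v * u2 v + p12 v * u1 v) / 2,
      E22 v * u1 v + p12 v * u2 v]"

text \<open>The second argument is the value of \<open>W\<^sub>x\<close>.\<close>

definition source :: "state \<Rightarrow> real \<Rightarrow> real ^ 6" where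
  "source v w = vector
     [0, - (rho v * w) / 2, 0, - (rho v * u1 v * w) / 2, - (rho v * u2 v * w) / 4, 0]"

definition sound :: "state \<Rightarrow> real" where "sound v = sqrt (3 * p11 v / rho v)"

text \<open>The distinct characteristic speeds; the fourth family has the speed of the third.\<close>

definition lam1 :: "state \<Rightarrow> real" where "lam1 v = u1 v - sound v"
definition lam2 :: "state \<Rightarrow> real" where "lam2 v = u1 v - sound v / sqrt 3"
definition lam3 :: "state \<Rightarrow> real" where "lam3 v = u1 v"
definition lam5 :: "state \<Rightarrow> real" where "lam5 v = u1 v + sound v / sqrt 3"

section \<open>Functions of \<open>(t, x)\<close>\<close>

definition dt :: "(real \<times> real \<Rightarrow> 'a::real_normed_vector) \<Rightarrow> real \<times> real \<Rightarrow> 'a" where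
  "dt f z = vector_derivative (\<lambda>t. f (t, snd z)) (at (fst z))"

definition dx :: "(real \<times> real \<Rightarrow> 'a::real_normed_vector) \<Rightarrow> real \<times> real \<Rightarrow> 'a" where
  "dx f z = vector_derivative (\<lambda>x. f (fst z, x)) (at (snd z))"

definition C1_on :: "(real \<times> real) set \<Rightarrow> (real \<times> real \<Rightarrow> 'a::real_normed_vector) \<Rightarrow> bool" where
  "C1_on A f \<longleftrightarrow> (\<forall>z\<in>A. f differentiable (at z)) \<and>
     continuous_on A (dt f) \<and> continuous_on A (dx f)"

definition has_origin_limit ::
  "(real \<times> real) set \<Rightarrow> (real \<times> real \<Rightarrow> 'a::real_normed_vector) \<Rightarrow> bool" where
  "has_origin_limit A f \<longleftrightarrow> (\<exists>l. (f \<longlongrightarrow> l) (at (0, 0) within A))"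

section \<open>The generalized Riemann problem\<close>

text \<open>
  A local solution \<open>sol\<close>, as a function of \<open>(t, x)\<close>, on the box \<open>0 < t < tmax\<close>,
  \<open>\<bar>x\<bar> < xmax\<close>. The curves \<open>x = w1l t\<close> and \<open>x = w1r t\<close> are the left and right edges of the
  1-wave (they coincide if it is a shock); \<open>w2\<close>, \<open>w3\<close>, \<open>w5\<close> are the 2-shear wave, the contact
  (families 3 and 4) and the 5-shear wave; \<open>w6\<close> is the 6-shock.
\<close>

record grp =
  pot :: "real \<Rightarrow> real"
  VL :: state
  VL' :: state
  VR :: state
  VR' :: state
  tmax :: real
  xmax :: real
  sol :: "real \<times> real \<Rightarrow> state"
  w1l :: "real \<Rightarrow> real"
  w1r :: "real \<Rightarrow> real"
  w2 :: "real \<Rightarrow> real"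
  w3 :: "real \<Rightarrow> real"
  w5 :: "real \<Rightarrow> real"
  w6 :: "real \<Rightarrow> real"

definition between :: "grp \<Rightarrow> (real \<Rightarrow> real) \<Rightarrow> (real \<Rightarrow> real) \<Rightarrow> (real \<times> real) set" where
  "between P a b = {(t, x). 0 < t \<and> t < tmax P \<and> a t < x \<and> x < b t}"

definition starR :: "grp \<Rightarrow> (real \<times> real) set" where
  "starR P = between P (w5 P) (w6 P)"

definition rightR :: "grp \<Rightarrow> (real \<times> real) set" where
  "rightR P = between P (w6 P) (\<lambda>t. xmax P)"

definition regions :: "grp \<Rightarrow> (real \<times> real) set set" where
  "regions P =
     {between P (\<lambda>t. - xmax P) (w1l P), between P (w1l P) (w1r P), between P (w1r P) (w2 P),
      between P (w2 P) (w3 P), between P (w3 P) (w5 P), starR P, rightR P}"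

definition fronts :: "grp \<Rightarrow> (real \<Rightarrow> real) set" where
  "fronts P = {w1l P, w1r P, w2 P, w3 P, w5 P, w6 P}"

text \<open>The derivative of a front; at \<open>t = 0\<close> it is the one-sided derivative.\<close>

definition speed :: "grp \<Rightarrow> (real \<Rightarrow> real) \<Rightarrow> real \<Rightarrow> real" where
  "speed P a t = vector_derivative a (at t within {0..<tmax P})"

definition smooth_front :: "grp \<Rightarrow> (real \<Rightarrow> real) \<Rightarrow> bool" where
  "smooth_front P a \<longleftrightarrow> a 0 = 0 \<and> a differentiable_on {0..<tmax P} \<and>
     continuous_on {0..<tmax P} (speed P a)"

definition has_traces :: "grp \<Rightarrow> (real \<Rightarrow> real) \<Rightarrow> real \<Rightarrow> bool" where
  "has_traces P a t \<longleftrightarrow>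
     (\<exists>l. ((\<lambda>x. sol P (t, x)) \<longlongrightarrow> l) (at_left (a t))) \<and>
     (\<exists>r. ((\<lambda>x. sol P (t, x)) \<longlongrightarrow> r) (at_right (a t)))"

definition traceL :: "grp \<Rightarrow> (real \<Rightarrow> real) \<Rightarrow> real \<Rightarrow> state" where
  "traceL P a t = Lim (at_left (a t)) (\<lambda>x. sol P (t, x))"

definition traceR :: "grp \<Rightarrow> (real \<Rightarrow> real) \<Rightarrow> real \<Rightarrow> state" where
  "traceR P a t = Lim (at_right (a t)) (\<lambda>x. sol P (t, x))"

definition rankine_hugoniot :: "grp \<Rightarrow> (real \<Rightarrow> real) \<Rightarrow> real \<Rightarrow> bool" where
  "rankine_hugoniot P a t \<longleftrightarrow>
     speed P a t *\<^sub>R (cons (traceR P a t) - cons (traceL P a t))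
       = flux (traceR P a t) - flux (traceL P a t)"

text \<open>A jump travelling with the (common) value of a linearly degenerate characteristic speed.\<close>

definition linear_wave :: "grp \<Rightarrow> (state \<Rightarrow> real) \<Rightarrow> (real \<Rightarrow> real) \<Rightarrow> bool" where
  "linear_wave P lam a \<longleftrightarrow> (\<forall>t. 0 < t \<and> t < tmax P \<longrightarrow>
     lam (traceL P a t) = speed P a t \<and> lam (traceR P a t) = speed P a t)"

text \<open>The non-strict Lax inequalities allow the 1-wave to be absent.\<close>

definition one_shock :: "grp \<Rightarrow> bool" where
  "one_shock P \<longleftrightarrow> (\<forall>t. 0 < t \<and> t < tmax P \<longrightarrow> w1l P t = w1r P t \<and>
     lam1 (traceR P (w1r P) t) \<le> speed P (w1r P) t \<and>
     speed P (w1r P) t \<le> lam1 (traceL P (w1r P) t))"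

definition one_rarefaction :: "grp \<Rightarrow> bool" where
  "one_rarefaction P \<longleftrightarrow> (\<forall>t. 0 < t \<and> t < tmax P \<longrightarrow> w1l P t < w1r P t \<and>
     (\<forall>a\<in>{w1l P, w1r P}. traceL P a t = traceR P a t \<and> speed P a t = lam1 (traceL P a t)))"

abbreviation VsR :: "grp \<Rightarrow> state" where
  "VsR P \<equiv> Lim (at (0, 0) within starR P) (sol P)"

abbreviation sigR :: "grp \<Rightarrow> real" where "sigR P \<equiv> speed P (w6 P) 0"

text \<open>Nonsonic configuration whose rightmost wave is a right-moving 6-shock.\<close>

locale grp_nonsonic_6shock =
  fixes P :: grp
  assumes box: "0 < tmax P" "0 < xmax P"
    and pot_C1: "pot P C1_differentiable_on UNIV"
    and data_admissible: "admissible (VL P)" "admissible (VR P)"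
    and initial_left: "\<And>x. - xmax P < x \<Longrightarrow> x < 0 \<Longrightarrow>
      ((\<lambda>t. sol P (t, x)) \<longlongrightarrow> VL P + x *\<^sub>R VL' P) (at_right 0)"
    and initial_right: "\<And>x. 0 < x \<Longrightarrow> x < xmax P \<Longrightarrow>
      ((\<lambda>t. sol P (t, x)) \<longlongrightarrow> VR P + x *\<^sub>R VR' P) (at_right 0)"
    and fronts_smooth: "\<And>a. a \<in> fronts P \<Longrightarrow> smooth_front P a"
    and fronts_ordered: "\<And>t. 0 < t \<Longrightarrow> t < tmax P \<Longrightarrow>
      - xmax P < w1l P t \<and> w1l P t \<le> w1r P t \<and> w1r P t < w2 P t \<and> w2 P t < w3 P t \<and>
      w3 P t < w5 P t \<and> w5 P t < w6 P t \<and> w6 P t < xmax P"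
    and sol_C1: "\<And>A. A \<in> regions P \<Longrightarrow> C1_on A (sol P)"
    and sol_admissible: "\<And>A z. A \<in> regions P \<Longrightarrow> z \<in> A \<Longrightarrow> admissible (sol P z)"
    and balance_law: "\<And>A z. A \<in> regions P \<Longrightarrow> z \<in> A \<Longrightarrow>
      dt (\<lambda>y. cons (sol P y)) z + dx (\<lambda>y. flux (sol P y)) z
        = source (sol P z) (deriv (pot P) (snd z))"
    and traces: "\<And>a t. a \<in> fronts P \<Longrightarrow> 0 < t \<Longrightarrow> t < tmax P \<Longrightarrow> has_traces P a t"
    and jump: "\<And>a t. a \<in> fronts P \<Longrightarrow> 0 < t \<Longrightarrow> t < tmax P \<Longrightarrow> rankine_hugoniot P a t"
    and wave1: "one_shock P \<or> one_rarefaction P"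
    and wave2: "linear_wave P lam2 (w2 P)"
    and wave3: "linear_wave P lam3 (w3 P)"
    and wave5: "linear_wave P lam5 (w5 P)"
    and shock_speed: "\<And>t. 0 < t \<Longrightarrow> t < tmax P \<Longrightarrow>
      speed P (w6 P) t = u1 (traceR P (w6 P) t) +
        sqrt ((2 * p11 (traceL P (w6 P) t) + p11 (traceR P (w6 P) t)) / rho (traceR P (w6 P) t))"
    and shock_density: "\<And>t. 0 < t \<Longrightarrow> t < tmax P \<Longrightarrow>
      rho (traceL P (w6 P) t) = rho (traceR P (w6 P) t) *
        ((2 * p11 (traceL P (w6 P) t) + p11 (traceR P (w6 P) t)) /
         (p11 (traceL P (w6 P) t) + 2 * p11 (traceR P (w6 P) t)))"
    and limits_starR: "has_origin_limit (starR P) (sol P)"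
      "has_origin_limit (starR P) (dt (sol P))" "has_origin_limit (starR P) (dx (sol P))"
    and limits_right: "has_origin_limit (rightR P) (sol P)"
      "has_origin_limit (rightR P) (dt (sol P))" "has_origin_limit (rightR P) (dx (sol P))"
    and star_admissible: "admissible (VsR P)"
    and shock_compressive: "p11 (VsR P) > p11 (VR P)"
    and shock_speed_origin:
      "sigR P = u1 (VR P) + sqrt ((2 * p11 (VsR P) + p11 (VR P)) / rho (VR P))"
    and nonsonic: "\<And>t. 0 < t \<Longrightarrow> t < tmax P \<Longrightarrow> w1r P t < 0 \<and> 0 < w6 P t"
    and moves_right: "sigR P > 0"

section \<open>Limits in the region to the left of the shock\<close>

definition limR :: "grp \<Rightarrow> (real \<times> real \<Rightarrow> real) \<Rightarrow> real" where
  "limR P f = Lim (at (0, 0) within starR P) f"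

text \<open>\<open>matd P q\<close> is the limit of the material derivative of the quantity \<open>q\<close>,
  \<open>par_t P q\<close> that of its time derivative. The assumption
  \<open>limits_starR\<close> makes \<open>Lim\<close> an actual limit here.\<close>

definition matd :: "grp \<Rightarrow> (state \<Rightarrow> real) \<Rightarrow> real" where
  "matd P q = limR P (\<lambda>z. dt (\<lambda>y. q (sol P y)) z + u1 (sol P z) * dx (\<lambda>y. q (sol P y)) z)"

definition par_t :: "grp \<Rightarrow> (state \<Rightarrow> real) \<Rightarrow> real" where
  "par_t P q = limR P (dt (\<lambda>y. q (sol P y)))"

abbreviation Wx0 :: "grp \<Rightarrow> real" where "Wx0 P \<equiv> deriv (pot P) 0"

section \<open>Derivatives along the shock\<close>

text \<open>
  The formulas for the derivatives along \<open>\<partial>\<^sub>t + \<sigma>\<^sub>R \<partial>\<^sub>x\<close>, in terms of the initial data and of limits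
  in \<open>starR\<close>. Names ending in \<open>_R\<close> refer to the right of the shock, those ending in \<open>_sR\<close> to its
  left.
\<close>

definition Ds_rho_R :: "grp \<Rightarrow> real" where
  "Ds_rho_R P = (sigR P - u1 (VR P)) * rho (VR' P) - rho (VR P) * u1 (VR' P)"

definition Ds_u1_R :: "grp \<Rightarrow> real" where
  "Ds_u1_R P = (sigR P - u1 (VR P)) * u1 (VR' P) - p11 (VR' P) / rho (VR P) - Wx0 P / 2"

definition Ds_u2_R :: "grp \<Rightarrow> real" where
  "Ds_u2_R P = (sigR P - u1 (VR P)) * u2 (VR' P) - p12 (VR' P) / rho (VR P)"

definition Ds_p11_R :: "grp \<Rightarrow> real" where
  "Ds_p11_R P = (sigR P - u1 (VR P)) * p11 (VR' P) - 3 * p11 (VR P) * u1 (VR' P)"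

definition Ds_p12_R :: "grp \<Rightarrow> real" where
  "Ds_p12_R P = (sigR P - u1 (VR P)) * p12 (VR' P)
     - 2 * p12 (VR P) * u1 (VR' P) - p11 (VR P) * u2 (VR' P)"

definition Ds_p22_R :: "grp \<Rightarrow> real" where
  "Ds_p22_R P = (sigR P - u1 (VR P)) * p22 (VR' P)
     - p22 (VR P) * u1 (VR' P) - 2 * p12 (VR P) * u2 (VR' P)"

definition Ds_p11_sR :: "grp \<Rightarrow> real" where
  "Ds_p11_sR P = matd P p11
     - rho (VsR P) * (sigR P - u1 (VsR P)) * (matd P u1 + Wx0 P / 2)"

definition Ds_sigma_R :: "grp \<Rightarrow> real" where
  "Ds_sigma_R P = Ds_u1_R P
     - sqrt (2 * p11 (VsR P) + p11 (VR P)) / (2 * rho (VR P) * sqrt (rho (VR P))) * Ds_rho_R P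
     + (Ds_p11_R P / 2 + Ds_p11_sR P) / sqrt (rho (VR P) * (2 * p11 (VsR P) + p11 (VR P)))"

definition H1R :: "grp \<Rightarrow> real" where
  "H1R P = 3 * rho (VR P) * p11 (VR P) / (p11 (VsR P) + 2 * p11 (VR P))\<^sup>2"

definition H2R :: "grp \<Rightarrow> real" where
  "H2R P = - (3 * rho (VR P) * p11 (VsR P)) / (p11 (VsR P) + 2 * p11 (VR P))\<^sup>2"

definition H3R :: "grp \<Rightarrow> real" where
  "H3R P = (2 * p11 (VsR P) + p11 (VR P)) / (p11 (VsR P) + 2 * p11 (VR P))"

definition Ds_rho_sR :: "grp \<Rightarrow> real" where
  "Ds_rho_sR P = H1R P * Ds_p11_sR P + H2R P * Ds_p11_R P + H3R P * Ds_rho_R P"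

definition Ds_u1_sR :: "grp \<Rightarrow> real" where
  "Ds_u1_sR P = par_t P u1 - sigR P / (3 * p11 (VsR P)) * matd P p11"

definition Ds_u2_sR :: "grp \<Rightarrow> real" where
  "Ds_u2_sR P = matd P u2 - (sigR P - u1 (VsR P)) / p11 (VsR P) *
     (matd P p12 - 2 * p12 (VsR P) / (3 * p11 (VsR P)) * matd P p11)"

definition Ds_p12_sR :: "grp \<Rightarrow> real" where
  "Ds_p12_sR P = matd P p12 - rho (VsR P) * (sigR P - u1 (VsR P)) * matd P u2"

text \<open>
  \<open>\<Gamma> = F - \<sigma> U\<close>, component by component, is continuous across the shock; these are the
  derivatives of its third, fifth and sixth components, evaluated on the right.
\<close>

definition Ds_Gam_m2_R :: "grp \<Rightarrow> real" where
  "Ds_Gam_m2_R P =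
     u2 (VR P) * (u1 (VR P) - sigR P) * Ds_rho_R P
     + rho (VR P) * u2 (VR P) * Ds_u1_R P
     + rho (VR P) * (u1 (VR P) - sigR P) * Ds_u2_R P
     + Ds_p12_R P
     - rho (VR P) * u2 (VR P) * Ds_sigma_R P"

definition Ds_Gam_E12_R :: "grp \<Rightarrow> real" where
  "Ds_Gam_E12_R P =
     1/2 * u1 (VR P) * u2 (VR P) * (u1 (VR P) - sigR P) * Ds_rho_R P
     + (2 * E12 (VR P) - 1/2 * rho (VR P) * u2 (VR P) * sigR P) * Ds_u1_R P
     + (E11 (VR P) - 1/2 * rho (VR P) * u1 (VR P) * sigR P) * Ds_u2_R P
     + 1/2 * u2 (VR P) * Ds_p11_R P
     + (u1 (VR P) - 1/2 * sigR P) * Ds_p12_R P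
     - E12 (VR P) * Ds_sigma_R P"

definition Ds_Gam_E22_R :: "grp \<Rightarrow> real" where
  "Ds_Gam_E22_R P =
     1/2 * (u2 (VR P))\<^sup>2 * (u1 (VR P) - sigR P) * Ds_rho_R P
     + E22 (VR P) * Ds_u1_R P
     + (2 * E12 (VR P) - rho (VR P) * u2 (VR P) * sigR P) * Ds_u2_R P
     + u2 (VR P) * Ds_p12_R P
     + 1/2 * (u1 (VR P) - sigR P) * Ds_p22_R P
     - E22 (VR P) * Ds_sigma_R P"

section \<open>Coefficients\<close>

definition a3R :: "grp \<Rightarrow> real" where
  "a3R P = 2 * rho (VsR P) * (u1 (VsR P) - sigR P)"

definition b3R :: "grp \<Rightarrow> real" where
  "b3R P = 1 + rho (VsR P) * (u1 (VsR P) - sigR P)\<^sup>2 / p11 (VsR P)"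

definition d3R :: "grp \<Rightarrow> real" where
  "d3R P = Ds_Gam_m2_R P
     + rho (VsR P) * u2 (VsR P) * Ds_sigma_R P
     - u2 (VsR P) * (u1 (VsR P) - sigR P) * Ds_rho_sR P
     - rho (VsR P) * u2 (VsR P) * Ds_u1_sR P
     + 2 * rho (VsR P) * p12 (VsR P) * (u1 (VsR P) - sigR P)\<^sup>2 / (3 * (p11 (VsR P))\<^sup>2) * matd P p11"

definition a4R :: "grp \<Rightarrow> real" where
  "a4R P = E11 (VsR P) + rho (VsR P) * (u1 (VsR P) - sigR P)\<^sup>2
     - 1/2 * rho (VsR P) * (sigR P)\<^sup>2"

definition b4R :: "grp \<Rightarrow> real" where
  "b4R P = (E11 (VsR P) - 1/2 * rho (VsR P) * u1 (VsR P) * sigR P)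
       * ((u1 (VsR P) - sigR P) / p11 (VsR P))
     + u1 (VsR P) - 1/2 * sigR P"

definition d4R :: "grp \<Rightarrow> real" where
  "d4R P = Ds_Gam_E12_R P
     + E12 (VsR P) * Ds_sigma_R P
     - 1/2 * u1 (VsR P) * u2 (VsR P) * (u1 (VsR P) - sigR P) * Ds_rho_sR P
     - 1/2 * u2 (VsR P) * Ds_p11_sR P
     - (2 * E12 (VsR P) - 1/2 * rho (VsR P) * u2 (VsR P) * sigR P) * Ds_u1_sR P
     + (E11 (VsR P) - 1/2 * rho (VsR P) * u1 (VsR P) * sigR P)
       * (2 * p12 (VsR P) * (u1 (VsR P) - sigR P) / (3 * (p11 (VsR P))\<^sup>2)) * matd P p11"

definition g_p22 :: "grp \<Rightarrow> real" where
  "g_p22 P = 1/2 * (u1 (VsR P) - sigR P)\<^sup>2"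

definition ft_p22 :: "grp \<Rightarrow> real" where
  "ft_p22 P = Ds_Gam_E22_R P
     + E22 (VsR P) * Ds_sigma_R P
     - 1/2 * (u2 (VsR P))\<^sup>2 * (u1 (VsR P) - sigR P) * Ds_rho_sR P
     - E22 (VsR P) * Ds_u1_sR P
     - (2 * E12 (VsR P) - rho (VsR P) * u2 (VsR P) * sigR P) * Ds_u2_sR P
     - u2 (VsR P) * Ds_p12_sR P"

definition f_p22 :: "grp \<Rightarrow> real" where
  "f_p22 P = u1 (VsR P) * ft_p22 P
     - (p11 (VsR P) * p22 (VsR P) - 4 * (p12 (VsR P))\<^sup>2) * (u1 (VsR P) - sigR P) * sigR P
         / (6 * (p11 (VsR P))\<^sup>2) * matd P p11
     - p12 (VsR P) * sigR P * (u1 (VsR P) - sigR P) / p11 (VsR P) * matd P p12"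

end

theory Submission
  imports Defs
begin

text \<open>
  Along the shock \<open>F - \<sigma> U\<close> is continuous, so the derivatives at the origin along \<open>\<partial>\<^sub>t + \<sigma>\<^sub>R \<partial>\<^sub>x\<close> of its
  traces from the two sides agree. From the right they are known: the initial data give the state and
  its space derivative, and the evolution equations give the time derivative. From the left, the
  primitive equations express the derivatives of \<open>u\<^sub>1\<close>, \<open>u\<^sub>2\<close>, \<open>p\<^sub>1\<^sub>1\<close>, \<open>p\<^sub>1\<^sub>2\<close> along the shock by material
  derivatives, and the density relation gives the derivative of \<open>\<rho>\<close>. The components for
  \<open>\<rho> u\<^sub>2\<close> and \<open>E\<^sub>1\<^sub>2\<close> therefore form a linear system for the material derivatives of \<open>u\<^sub>2\<close> and \<open>p\<^sub>1\<^sub>2\<close>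
  (\<open>linear_system\<close>), and the component for \<open>E\<^sub>2\<^sub>2\<close> determines \<open>p\<^sub>2\<^sub>2\<close> (\<open>p22_equation\<close>).

  The determinant of the linear system is \<open>- (m - p\<^sub>1\<^sub>1)\<^sup>2 / (2 p\<^sub>1\<^sub>1)\<close>, where \<open>m = \<rho> (u\<^sub>1 - \<sigma>\<^sub>R)\<^sup>2\<close> is taken
  behind the shock. Conservation of mass together with the formulas for the shock speed and density
  gives \<open>m = p\<^sub>1\<^sub>1 + 2 p\<^sub>1\<^sub>1\<^sub>,\<^sub>R\<close>, so the determinant is never zero (\<open>det_nonzero\<close>).

  The analytic content is that the traces are differentiable at the origin with the expected
  derivative, although only limits of the solution and of its first derivatives inside the two
  regions are given. An expansion that is uniform over all curves of nearly the slope of the shock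
  (\<open>uniform_expansion_along_curves\<close>) is applied to curves inside the region, which are then moved
  onto the shock (\<open>one_sided_trace_has_vector_derivative\<close>). To the right of the shock the corner
  limits have to be identified with the initial data (\<open>corner_limits_from_initial_data\<close>).
\<close>

section \<open>Vectors with six components\<close>

lemma exhaust_6:
  fixes i :: 6
  shows "i = 1 \<or> i = 2 \<or> i = 3 \<or> i = 4 \<or> i = 5 \<or> i = 6"
proof (induct i)
  case (of_int z)
  then have "0 \<le> z" and "z < 6" by simp_all
  then have "z = 0 \<or> z = 1 \<or> z = 2 \<or> z = 3 \<or> z = 4 \<or> z = 5" by arith
  then show ?case by auto
qed

lemma forall_6: "(\<forall>i::6. Q i) \<longleftrightarrow> Q 1 \<and> Q 2 \<and> Q 3 \<and> Q 4 \<and> Q 5 \<and> Q 6"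
proof (intro iffI allI)
  fix i :: 6
  assume "Q 1 \<and> Q 2 \<and> Q 3 \<and> Q 4 \<and> Q 5 \<and> Q 6"
  then show "Q i" using exhaust_6[of i] by (elim disjE) simp_all
qed simp

lemma differentiable_vec_componentwise:
  fixes f :: "'a::real_normed_vector \<Rightarrow> real ^ 'n"
  assumes "\<And>i. (\<lambda>x. f x $ i) differentiable (at x within S)"
  shows "f differentiable (at x within S)"
proof (subst differentiable_componentwise_within, rule ballI)
  fix b :: "real ^ 'n"
  assume "b \<in> Basis"
  then obtain i where "b = axis i 1" by (auto simp: Basis_vec_def)
  then have "(\<lambda>x. f x \<bullet> b) = (\<lambda>x. f x $ i)" by (simp add: inner_axis)
  then show "(\<lambda>x. f x \<bullet> b) differentiable (at x within S)" using assms by simp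
qed

section \<open>Partial derivatives in time and space\<close>

text \<open>
  The partial derivatives are ordinary derivatives of slices, hence carry no information about
  other directions; differentiability at the point is what makes them determine the derivative
  along every curve.
\<close>

lemma differentiable_has_derivative_dt_dx:
  fixes f :: "real \<times> real \<Rightarrow> 'a::real_normed_vector"
  assumes "f differentiable (at z)"
  shows "(f has_derivative (\<lambda>h. fst h *\<^sub>R dt f z + snd h *\<^sub>R dx f z)) (at z)"
proof -
  obtain D where D: "(f has_derivative D) (at z)"
    using assms by (auto simp: differentiable_def)
  interpret D: bounded_linear D using D by (rule has_derivative_bounded_linear)
  have h1: "(\<lambda>h. D (h, 0)) = (\<lambda>h. h *\<^sub>R D (1, 0))"
    and h2: "(\<lambda>h. D (0, h)) = (\<lambda>h. h *\<^sub>R D (0, 1))"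
    by (simp_all flip: D.scaleR)
  have "((\<lambda>t. f (t, snd z)) has_derivative (\<lambda>h. D (h, 0))) (at (fst z))"
    by (rule has_derivative_compose[of "\<lambda>t. (t, snd z)"]) (auto intro!: derivative_eq_intros D)
  then have t: "dt f z = D (1, 0)"
    unfolding dt_def h1 by (intro vector_derivative_at) (simp only: has_vector_derivative_def)
  have "((\<lambda>x. f (fst z, x)) has_derivative (\<lambda>h. D (0, h))) (at (snd z))"
    by (rule has_derivative_compose[of "\<lambda>x. (fst z, x)"]) (auto intro!: derivative_eq_intros D)
  then have x: "dx f z = D (0, 1)"
    unfolding dx_def h2 by (intro vector_derivative_at) (simp only: has_vector_derivative_def)
  have "D h = fst h *\<^sub>R dt f z + snd h *\<^sub>R dx f z" for h
    unfolding t x by (simp flip: D.scaleR D.add)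
  then show ?thesis using D by presburger
qed

lemma differentiable_has_vector_derivative_along_graph:
  fixes f :: "real \<times> real \<Rightarrow> 'a::real_normed_vector"
  assumes f: "f differentiable (at (s, c s))" and c: "(c has_real_derivative d) (at s)"
  shows "((\<lambda>s. f (s, c s)) has_vector_derivative (dt f (s, c s) + d *\<^sub>R dx f (s, c s))) (at s)"
proof -
  have "((\<lambda>s. (s, c s)) has_derivative (\<lambda>h. (h, d * h))) (at s)"
    using c by (auto intro!: derivative_eq_intros simp: has_field_derivative_def)
  from has_derivative_compose[OF this differentiable_has_derivative_dt_dx[OF f]]
  show ?thesis
    by (simp add: has_vector_derivative_def algebra_simps)
qed

lemma differentiable_has_vector_derivative_dt:
  fixes f :: "real \<times> real \<Rightarrow> 'a::real_normed_vector"
  assumes "f differentiable (at z)"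
  shows "((\<lambda>t. f (t, snd z)) has_vector_derivative dt f z) (at (fst z))"
  using differentiable_has_vector_derivative_along_graph[of f "fst z" "\<lambda>_. snd z" 0] assms by simp

lemma differentiable_has_vector_derivative_dx:
  fixes f :: "real \<times> real \<Rightarrow> 'a::real_normed_vector"
  assumes f: "f differentiable (at z)"
  shows "((\<lambda>x. f (fst z, x)) has_vector_derivative dx f z) (at (snd z))"
proof -
  have "((\<lambda>x. (fst z, x)) has_derivative (\<lambda>h. (0, h))) (at (snd z))"
    by (auto intro!: derivative_eq_intros)
  from has_derivative_compose[OF this, of f "\<lambda>h. fst h *\<^sub>R dt f z + snd h *\<^sub>R dx f z"]
    differentiable_has_derivative_dt_dx[OF f]
  show ?thesis
    by (simp add: has_vector_derivative_def)
qed

lemma dt_vec_nth: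
  fixes f :: "real \<times> real \<Rightarrow> real ^ 'n"
  assumes "f differentiable (at z)"
  shows "dt (\<lambda>y. f y $ i) z = dt f z $ i"
  using bounded_linear.has_vector_derivative[OF bounded_linear_vec_nth
      differentiable_has_vector_derivative_dt[OF assms]]
  unfolding dt_def[of "\<lambda>y. f y $ i"] by (rule vector_derivative_at)

lemma dx_vec_nth:
  fixes f :: "real \<times> real \<Rightarrow> real ^ 'n"
  assumes "f differentiable (at z)"
  shows "dx (\<lambda>y. f y $ i) z = dx f z $ i"
  using bounded_linear.has_vector_derivative[OF bounded_linear_vec_nth
      differentiable_has_vector_derivative_dx[OF assms]]
  unfolding dx_def[of "\<lambda>y. f y $ i"] by (rule vector_derivative_at)

section \<open>Expansions at the corner of a region\<close>

text \<open>
  Along a curve the difference between \<open>f\<close> and its expected first-order expansion has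
  derivative \<open>dt f + c' dx f - (T + \<sigma> X)\<close>, which is small near the corner as soon as the slope
  \<open>c'\<close> is close to \<open>\<sigma>\<close>; the mean value inequality then bounds the difference by \<open>e * t\<close>.
  The point is that \<open>\<delta>\<close> does not depend on the curve: this is what allows the curves to be moved
  to the boundary of the region afterwards.
\<close>

lemma uniform_expansion_along_curves:
  fixes f :: "real \<times> real \<Rightarrow> 'a::real_normed_vector"
  assumes diff: "\<And>z. z \<in> A \<Longrightarrow> f differentiable (at z)"
    and f: "(f \<longlongrightarrow> L) (at (0, 0) within A)"
    and T: "(dt f \<longlongrightarrow> T) (at (0, 0) within A)"
    and X: "(dx f \<longlongrightarrow> X) (at (0, 0) within A)"
    and "0 < e"
  obtains \<delta> where "0 < \<delta>"
    and "\<And>t c c'. 0 < t \<Longrightarrow> t < \<delta> \<Longrightarrow> (c \<longlongrightarrow> 0) (at_right 0) \<Longrightarrow>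
      (\<And>s. 0 < s \<Longrightarrow> s \<le> t \<Longrightarrow> (s, c s) \<in> A \<and> \<bar>c s\<bar> < \<delta> \<and>
         (c has_real_derivative c' s) (at s) \<and> \<bar>c' s - \<sigma>\<bar> < \<delta>) \<Longrightarrow>
      norm (f (t, c t) - L - t *\<^sub>R (T + \<sigma> *\<^sub>R X)) \<le> e * t"
proof -
  let ?F = "at (0, 0) within A" and ?D = "T + \<sigma> *\<^sub>R X"
  \<comment> \<open>The slope is treated as a second, independent variable tending to \<open>\<sigma>\<close>.\<close>
  have "((\<lambda>y. dt f (fst y) + snd y *\<^sub>R dx f (fst y)) \<longlongrightarrow> ?D) (?F \<times>\<^sub>F nhds \<sigma>)"
    by (intro tendsto_intros filterlim_compose[OF T] filterlim_compose[OF X]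
        filterlim_fst filterlim_snd)
  then have "\<forall>\<^sub>F y in ?F \<times>\<^sub>F nhds \<sigma>. norm (dt f (fst y) + snd y *\<^sub>R dx f (fst y) - ?D) < e"
    using \<open>0 < e\<close> by (simp add: tendsto_iff dist_norm)
  then obtain Pf Pg where P: "eventually Pf ?F" "eventually Pg (nhds \<sigma>)"
      "\<And>z d. Pf z \<Longrightarrow> Pg d \<Longrightarrow> norm (dt f z + d *\<^sub>R dx f z - ?D) < e"
    unfolding eventually_prod_filter by auto
  obtain r1 where r1: "0 < r1" "\<And>z. z \<in> A \<Longrightarrow> z \<noteq> (0, 0) \<Longrightarrow> dist z (0, 0) < r1 \<Longrightarrow> Pf z"
    using P(1) unfolding eventually_at by blast
  obtain r2 where r2: "0 < r2" "\<And>d. dist d \<sigma> < r2 \<Longrightarrow> Pg d"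
    using P(2) unfolding eventually_nhds_metric by blast
  define \<delta> where "\<delta> = min (r1 / 2) r2"
  have \<delta>: "0 < \<delta>" "\<delta> \<le> r1 / 2" "\<delta> \<le> r2" using r1(1) r2(1) by (auto simp: \<delta>_def)
  show thesis
  proof (rule that[OF \<delta>(1)])
    fix t :: real and c c' :: "real \<Rightarrow> real"
    assume t: "0 < t" "t < \<delta>" and c0: "(c \<longlongrightarrow> 0) (at_right 0)"
      and c: "\<And>s. 0 < s \<Longrightarrow> s \<le> t \<Longrightarrow> (s, c s) \<in> A \<and> \<bar>c s\<bar> < \<delta> \<and>
         (c has_real_derivative c' s) (at s) \<and> \<bar>c' s - \<sigma>\<bar> < \<delta>"
    define g where "g s = (if s = 0 then L else f (s, c s)) - s *\<^sub>R ?D" for s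
    have near: "norm (dt f (s, c s) + c' s *\<^sub>R dx f (s, c s) - ?D) \<le> e" if "0 < s" "s \<le> t" for s
    proof -
      have "dist (s, c s) (0, 0) \<le> \<bar>s\<bar> + \<bar>c s\<bar>"
        using sqrt_sum_squares_le_sum_abs[of s "c s"] by (simp add: dist_norm norm_Pair)
      also have "\<dots> < r1" using c[OF that] \<delta>(2) that t by auto
      finally have "Pf (s, c s)" using r1(2)[of "(s, c s)"] c[OF that] that by auto
      moreover have "Pg (c' s)" using r2(2)[of "c' s"] c[OF that] \<delta>(3) by (auto simp: dist_real_def)
      ultimately show ?thesis using P(3) by (meson less_imp_le)
    qed
    have deriv: "(g has_vector_derivative (dt f (s, c s) + c' s *\<^sub>R dx f (s, c s) - ?D)) (at s)"
      if "0 < s" "s \<le> t" for s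
    proof -
      have "((\<lambda>s. f (s, c s) - s *\<^sub>R ?D) has_vector_derivative
          (dt f (s, c s) + c' s *\<^sub>R dx f (s, c s) - ?D)) (at s)"
        using differentiable_has_vector_derivative_along_graph[of f s c "c' s"] c[OF that] diff
        by (auto intro!: derivative_eq_intros)
      then show ?thesis
        by (rule has_vector_derivative_transform_within[of _ _ _ _ s])
          (use that in \<open>auto simp: g_def dist_real_def\<close>)
    qed
    have "filterlim (\<lambda>s. (s, c s)) ?F (at_right 0)"
      unfolding filterlim_at
    proof
      show "((\<lambda>s. (s, c s)) \<longlongrightarrow> (0, 0)) (at_right 0)" by (intro tendsto_Pair c0 tendsto_ident_at)
      show "\<forall>\<^sub>F s in at_right 0. (s, c s) \<in> A \<and> (s, c s) \<noteq> (0, 0)"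
        using c t by (auto intro!: eventually_at_rightI[of 0 t])
    qed
    then have "((\<lambda>s. f (s, c s) - s *\<^sub>R ?D) \<longlongrightarrow> L - 0 *\<^sub>R ?D) (at_right 0)"
      by (intro tendsto_intros filterlim_compose[OF f])
    moreover have "\<forall>\<^sub>F s in at_right 0. f (s, c s) - s *\<^sub>R ?D = g s"
      by (rule eventually_at_rightI[of 0 1]) (auto simp: g_def)
    ultimately have g0: "(g \<longlongrightarrow> g 0) (at_right 0)"
      unfolding g_def[of 0] by (auto dest: Lim_transform_eventually)
    have "continuous_on {0..t} g"
      unfolding continuous_on_eq_continuous_within
    proof
      fix s assume s: "s \<in> {0..t}"
      show "continuous (at s within {0..t}) g"
      proof (cases "s = 0")
        case True
        then show ?thesis using g0 t by (simp add: continuous_within at_within_Icc_at_right)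
      next
        case False
        then show ?thesis using s
          by (intro continuous_at_imp_continuous_within[OF has_vector_derivative_continuous[OF deriv]])
            auto
      qed
    qed
    then have "norm (g t - g 0) \<le> e * t - e * 0"
      by (rule differentiable_bound_general[where \<phi>'="\<lambda>_. e" and \<phi> = "\<lambda>s. e * s", OF t(1)])
        (auto intro!: continuous_intros derivative_eq_intros deriv near
          simp flip: has_real_derivative_iff_has_vector_derivative)
    then show "norm (f (t, c t) - L - t *\<^sub>R ?D) \<le> e * t"
      using t by (simp add: g_def algebra_simps)
  qed
qed

text \<open>
  The boundary curve \<open>w\<close> lies outside \<open>A\<close>, so \<open>f\<close> cannot be differentiated along it. It is
  approximated by the curves \<open>w + l * h\<close>, which run inside \<open>A\<close> for small \<open>l > 0\<close>. The expansion of
  \<open>f\<close> along these is uniform in \<open>l\<close>, and for each fixed time it passes to the trace as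
  \<open>l\<close> tends to 0.
\<close>

lemma one_sided_trace_has_vector_derivative:
  fixes f :: "real \<times> real \<Rightarrow> 'a::real_normed_vector"
  assumes diff: "\<And>z. z \<in> A \<Longrightarrow> f differentiable (at z)"
    and lims: "(f \<longlongrightarrow> L) (at (0, 0) within A)" "(dt f \<longlongrightarrow> T) (at (0, 0) within A)"
      "(dx f \<longlongrightarrow> X) (at (0, 0) within A)"
    and w0: "(w \<longlongrightarrow> 0) (at_right 0)" and w'0: "(w' \<longlongrightarrow> \<sigma>) (at_right 0)"
    and h0: "(h \<longlongrightarrow> 0) (at_right 0)" and h'0: "(h' \<longlongrightarrow> \<kappa>) (at_right 0)"
    and "0 < \<tau>"
    and w: "\<And>s. 0 < s \<Longrightarrow> s < \<tau> \<Longrightarrow> (w has_real_derivative w' s) (at s)"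
    and h: "\<And>s. 0 < s \<Longrightarrow> s < \<tau> \<Longrightarrow> (h has_real_derivative h' s) (at s)"
    and inside: "\<forall>\<^sub>F s in at_right 0. \<forall>l. 0 < l \<and> l < 1 \<longrightarrow> (s, w s + l * h s) \<in> A"
    and trace: "\<And>s. 0 < s \<Longrightarrow> s < \<tau> \<Longrightarrow> ((\<lambda>l. f (s, w s + l * h s)) \<longlongrightarrow> g s) (at_right 0)"
    and g0: "g 0 = L"
  shows "(g has_vector_derivative (T + \<sigma> *\<^sub>R X)) (at 0 within {0..<\<tau>})"
  unfolding has_vector_derivative_def has_derivative_within_alt
proof (intro conjI allI impI)
  show "bounded_linear (\<lambda>s. s *\<^sub>R (T + \<sigma> *\<^sub>R X))" by (rule bounded_linear_scaleR_left)
  fix e :: real assume "0 < e"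
  obtain \<delta> where \<delta>: "0 < \<delta>" and
    est: "\<And>t c c'. 0 < t \<Longrightarrow> t < \<delta> \<Longrightarrow> (c \<longlongrightarrow> 0) (at_right 0) \<Longrightarrow>
      (\<And>s. 0 < s \<Longrightarrow> s \<le> t \<Longrightarrow> (s, c s) \<in> A \<and> \<bar>c s\<bar> < \<delta> \<and>
         (c has_real_derivative c' s) (at s) \<and> \<bar>c' s - \<sigma>\<bar> < \<delta>) \<Longrightarrow>
      norm (f (t, c t) - L - t *\<^sub>R (T + \<sigma> *\<^sub>R X)) \<le> e * t"
    using uniform_expansion_along_curves[OF diff lims \<open>0 < e\<close>, where \<sigma> = \<sigma>] by blast
  \<comment> \<open>An upper bound for the slopes \<open>h'\<close> near 0.\<close>
  define M where "M = \<bar>\<kappa>\<bar> + 1"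
  have small: "\<forall>\<^sub>F s in at_right 0. \<bar>u s - a\<bar> < r" if "(u \<longlongrightarrow> a) (at_right 0)" "0 < r"
    for u :: "real \<Rightarrow> real" and a r
    using that by (auto simp: tendsto_iff dist_real_def)
  have "\<forall>\<^sub>F s in at_right 0. \<bar>w s - 0\<bar> < \<delta> / 2 \<and> \<bar>h s - 0\<bar> < \<delta> / 2 \<and> \<bar>w' s - \<sigma>\<bar> < \<delta> / 2 \<and>
      \<bar>h' s - \<kappa>\<bar> < 1 \<and> (\<forall>l. 0 < l \<and> l < 1 \<longrightarrow> (s, w s + l * h s) \<in> A)"
    using \<delta> by (intro eventually_conj small w0 h0 w'0 h'0 inside) auto
  then obtain d0 where "0 < d0" and d0:
    "\<And>s. 0 < s \<Longrightarrow> s < d0 \<Longrightarrow> \<bar>w s\<bar> < \<delta> / 2 \<and> \<bar>h s\<bar> < \<delta> / 2 \<and> \<bar>w' s - \<sigma>\<bar> < \<delta> / 2 \<and>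
      \<bar>h' s - \<kappa>\<bar> < 1 \<and> (\<forall>l. 0 < l \<and> l < 1 \<longrightarrow> (s, w s + l * h s) \<in> A)"
    unfolding eventually_at_right_field by auto
  define d where "d = min d0 (min \<delta> \<tau>)"
  have d: "0 < d" "d \<le> d0" "d \<le> \<delta>" "d \<le> \<tau>"
    using \<open>0 < d0\<close> \<delta> \<open>0 < \<tau>\<close> by (auto simp: d_def)
  have main: "norm (g t - L - t *\<^sub>R (T + \<sigma> *\<^sub>R X)) \<le> e * t" if t: "0 < t" "t < d" for t
  proof (rule tendsto_upperbound)
    show "((\<lambda>l. norm (f (t, w t + l * h t) - L - t *\<^sub>R (T + \<sigma> *\<^sub>R X))) \<longlongrightarrow>
        norm (g t - L - t *\<^sub>R (T + \<sigma> *\<^sub>R X))) (at_right 0)"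
      using t d by (intro tendsto_intros trace) auto
    show "\<forall>\<^sub>F l in at_right 0. norm (f (t, w t + l * h t) - L - t *\<^sub>R (T + \<sigma> *\<^sub>R X)) \<le> e * t"
    proof (rule eventually_at_rightI)
      show "0 < min 1 (\<delta> / (2 * M))" using \<delta> by (simp add: M_def)
      fix l assume "l \<in> {0<..<min 1 (\<delta> / (2 * M))}"
      then have l: "0 < l" "l < 1" and "l < \<delta> / (2 * M)" by auto
      then have lM: "l * M < \<delta> / 2" by (simp add: M_def field_simps)
      show "norm (f (t, w t + l * h t) - L - t *\<^sub>R (T + \<sigma> *\<^sub>R X)) \<le> e * t"
      proof (rule est[where c = "\<lambda>s. w s + l * h s" and c' = "\<lambda>s. w' s + l * h' s"])
        show "((\<lambda>s. w s + l * h s) \<longlongrightarrow> 0) (at_right 0)"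
          using tendsto_add[OF w0 tendsto_mult_left[OF h0, of l]] by simp
      next
        fix s assume s: "0 < s" "s \<le> t"
        with t d have s': "s < d0" "s < \<tau>" by auto
        note D = d0[OF s(1) s'(1)]
        have "\<bar>l * h s\<bar> \<le> 1 * \<bar>h s\<bar>" unfolding abs_mult using l by (intro mult_right_mono) auto
        then have "\<bar>w s + l * h s\<bar> < \<delta>" using D by linarith
        moreover have "\<bar>h' s\<bar> \<le> M" using D unfolding M_def by linarith
        then have "\<bar>l * h' s\<bar> \<le> l * M" unfolding abs_mult using l by (simp add: mult_left_mono)
        then have "\<bar>w' s + l * h' s - \<sigma>\<bar> < \<delta>" using D lM by linarith
        moreover have "((\<lambda>s. w s + l * h s) has_real_derivative w' s + l * h' s) (at s)"
          using w[OF s(1) s'(2)] h[OF s(1) s'(2)] by (auto intro!: derivative_eq_intros)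
        ultimately show "(s, w s + l * h s) \<in> A \<and> \<bar>w s + l * h s\<bar> < \<delta> \<and>
           ((\<lambda>s. w s + l * h s) has_real_derivative w' s + l * h' s) (at s) \<and>
           \<bar>w' s + l * h' s - \<sigma>\<bar> < \<delta>"
          using D l by blast
      qed (use t d in auto)
    qed
  qed simp
  show "\<exists>d>0. \<forall>t\<in>{0..<\<tau>}. norm (t - 0) < d \<longrightarrow>
      norm (g t - g 0 - (t - 0) *\<^sub>R (T + \<sigma> *\<^sub>R X)) \<le> e * norm (t - 0)"
  proof (intro exI[of _ d] conjI ballI impI d(1))
    fix t assume t: "t \<in> {0..<\<tau>}" "norm (t - 0) < d"
    show "norm (g t - g 0 - (t - 0) *\<^sub>R (T + \<sigma> *\<^sub>R X)) \<le> e * norm (t - 0)"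
    proof (cases "t = 0")
      case False
      then show ?thesis using main[of t] t g0 by simp
    qed simp
  qed
qed

text \<open>
  The initial data are attained only as \<open>t\<close> tends to 0 with \<open>x\<close> fixed, whereas \<open>L\<close> and \<open>X\<close> are
  limits at the corner. For \<open>L\<close> the two limits are exchanged directly. For \<open>X\<close> the derivative is
  first replaced by the increment of \<open>f\<close> over a short interval \<open>{x1..x2}\<close>, which does converge as
  \<open>t\<close> tends to 0.
\<close>

lemma corner_limits_from_initial_data:
  fixes f :: "real \<times> real \<Rightarrow> 'a::real_normed_vector"
  assumes diff: "\<And>z. z \<in> A \<Longrightarrow> f differentiable (at z)"
    and f: "(f \<longlongrightarrow> L) (at (0, 0) within A)" and X: "(dx f \<longlongrightarrow> X) (at (0, 0) within A)"
    and "0 < b"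
    and inside: "\<And>x. 0 < x \<Longrightarrow> \<forall>\<^sub>F t in at_right 0. \<forall>y. x \<le> y \<and> y < b \<longrightarrow> (t, y) \<in> A"
    and init: "\<And>x. 0 < x \<Longrightarrow> x < b \<Longrightarrow> ((\<lambda>t. f (t, x)) \<longlongrightarrow> V + x *\<^sub>R V') (at_right 0)"
  shows "L = V" and "X = V'"
proof -
  have near: "\<exists>r>0. \<forall>t y. (t, y) \<in> A \<longrightarrow> 0 < t \<longrightarrow> t < r \<longrightarrow> 0 < y \<longrightarrow> y < r \<longrightarrow> norm (q (t, y) - l) < e"
    if q: "(q \<longlongrightarrow> l) (at (0, 0) within A)" and "0 < e" for q :: "real \<times> real \<Rightarrow> 'a" and l e
  proof -
    have "\<forall>\<^sub>F z in at (0, 0) within A. norm (q z - l) < e"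
      using q \<open>0 < e\<close> by (simp add: tendsto_iff dist_norm)
    then obtain r where r: "0 < r"
        "\<And>z. z \<in> A \<Longrightarrow> z \<noteq> (0, 0) \<Longrightarrow> dist z (0, 0) < r \<Longrightarrow> norm (q z - l) < e"
      unfolding eventually_at by blast
    have "norm (q (t, y) - l) < e" if "(t, y) \<in> A" "0 < t" "t < r / 2" "0 < y" "y < r / 2" for t y
    proof -
      have "dist (t, y) (0, 0) \<le> \<bar>t\<bar> + \<bar>y\<bar>"
        using sqrt_sum_squares_le_sum_abs[of t y] by (simp add: dist_norm norm_Pair)
      then show ?thesis using r(2)[of "(t, y)"] that by auto
    qed
    then show ?thesis using r(1) by (intro exI[of _ "r / 2"]) auto
  qed
  show "L = V"
  proof (rule ccontr)
    assume "L \<noteq> V"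
    define e where "e = norm (V - L) / 2"
    have "0 < e" using \<open>L \<noteq> V\<close> by (simp add: e_def)
    obtain r where "0 < r" and r: "\<And>t y. (t, y) \<in> A \<Longrightarrow> 0 < t \<Longrightarrow> t < r \<Longrightarrow> 0 < y \<Longrightarrow> y < r \<Longrightarrow>
        norm (f (t, y) - L) < e"
      using near[OF f \<open>0 < e\<close>] by blast
    have "norm (V + x *\<^sub>R V' - L) \<le> e" if x: "x \<in> {0<..<min r b}" for x
    proof (rule tendsto_upperbound)
      show "((\<lambda>t. norm (f (t, x) - L)) \<longlongrightarrow> norm (V + x *\<^sub>R V' - L)) (at_right 0)"
        using x by (intro tendsto_intros init) auto
      have "\<forall>\<^sub>F t in at_right 0. t < r \<and> 0 < t"
        using \<open>0 < r\<close> by (intro eventually_at_rightI[of 0 r]) auto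
      moreover have "\<forall>\<^sub>F t in at_right 0. \<forall>y. x \<le> y \<and> y < b \<longrightarrow> (t, y) \<in> A"
        using inside x by simp
      ultimately show "\<forall>\<^sub>F t in at_right 0. norm (f (t, x) - L) \<le> e"
        by eventually_elim (use r x in \<open>auto intro!: less_imp_le\<close>)
    qed simp
    then have "\<forall>\<^sub>F x in at_right 0. norm (V + x *\<^sub>R V' - L) \<le> e"
      using \<open>0 < r\<close> \<open>0 < b\<close> by (intro eventually_at_rightI[of 0 "min r b"]) auto
    moreover have "((\<lambda>x. norm (V + x *\<^sub>R V' - L)) \<longlongrightarrow> norm (V + 0 *\<^sub>R V' - L)) (at_right 0)"
      by (intro tendsto_intros)
    ultimately have "norm (V + 0 *\<^sub>R V' - L) \<le> e"
      by (intro tendsto_upperbound[where F = "at_right 0"]) auto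
    then show False using \<open>0 < e\<close> by (simp add: e_def)
  qed
  show "X = V'"
  proof (rule ccontr)
    assume "X \<noteq> V'"
    define e where "e = norm (V' - X) / 2"
    have "0 < e" using \<open>X \<noteq> V'\<close> by (simp add: e_def)
    obtain r where "0 < r" and r: "\<And>t y. (t, y) \<in> A \<Longrightarrow> 0 < t \<Longrightarrow> t < r \<Longrightarrow> 0 < y \<Longrightarrow> y < r \<Longrightarrow>
        norm (dx f (t, y) - X) < e"
      using near[OF X \<open>0 < e\<close>] by blast
    define x2 where "x2 = min r b / 2"
    define x1 where "x1 = x2 / 2"
    have x: "0 < x1" "x1 < x2" "x2 < r" "x2 < b"
      using \<open>0 < r\<close> \<open>0 < b\<close> by (auto simp: x1_def x2_def)
    have "norm (f (t, x2) - x2 *\<^sub>R X - (f (t, x1) - x1 *\<^sub>R X)) \<le> e * x2 - e * x1"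
      if t: "0 < t" "t < r" and A: "\<forall>y. x1 \<le> y \<and> y < b \<longrightarrow> (t, y) \<in> A" for t
    proof (rule differentiable_bound_general[where \<phi>'="\<lambda>_. e" and \<phi> = "\<lambda>s. e * s", OF x(2)])
      have deriv: "((\<lambda>y. f (t, y) - y *\<^sub>R X) has_vector_derivative (dx f (t, y) - X)) (at y)"
        if "x1 \<le> y" "y \<le> x2" for y
        using differentiable_has_vector_derivative_dx[of f "(t, y)"] diff A that x
        by (auto intro!: derivative_eq_intros)
      then show "((\<lambda>y. f (t, y) - y *\<^sub>R X) has_vector_derivative (dx f (t, y) - X)) (at y)"
        if "x1 < y" "y < x2" for y using that by simp
      show "continuous_on {x1..x2} (\<lambda>y. f (t, y) - y *\<^sub>R X)"
        using has_vector_derivative_continuous[OF deriv]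
        by (intro continuous_at_imp_continuous_on) auto
      show "norm (dx f (t, y) - X) \<le> e" if "x1 < y" "y < x2" for y
        using r[of t y] A that x t by (auto intro!: less_imp_le)
    qed (auto intro!: continuous_intros derivative_eq_intros
          simp flip: has_real_derivative_iff_has_vector_derivative)
    moreover have "\<forall>\<^sub>F t in at_right 0. 0 < t \<and> t < r"
      using \<open>0 < r\<close> by (intro eventually_at_rightI[of 0 r]) auto
    ultimately have ev: "\<forall>\<^sub>F t in at_right 0.
        norm (f (t, x2) - x2 *\<^sub>R X - (f (t, x1) - x1 *\<^sub>R X)) \<le> e * x2 - e * x1"
      using inside[OF x(1)] by (auto elim: eventually_elim2)
    have "norm (V + x2 *\<^sub>R V' - x2 *\<^sub>R X - (V + x1 *\<^sub>R V' - x1 *\<^sub>R X)) \<le> e * x2 - e * x1"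
      using x by (intro tendsto_upperbound[OF _ ev] tendsto_intros init) auto
    also have "V + x2 *\<^sub>R V' - x2 *\<^sub>R X - (V + x1 *\<^sub>R V' - x1 *\<^sub>R X) = (x2 - x1) *\<^sub>R (V' - X)"
      by (simp add: algebra_simps)
    also have "norm \<dots> = (x2 - x1) * norm (V' - X)" using x by simp
    finally have "(x2 - x1) * norm (V' - X) \<le> (x2 - x1) * e"
      by (simp add: algebra_simps)
    then have "norm (V' - X) \<le> e" using x by simp
    then show False using \<open>0 < e\<close> by (simp add: e_def)
  qed
qed

section \<open>The system in primitive variables\<close>

text \<open>
  Left side minus right side of the equations for the primitive variables, for a state \<open>v\<close> with time
  derivative \<open>a\<close>, space derivative \<open>b\<close> and potential gradient \<open>w\<close>. The two momentum rows are
  multiplied by the density, so that every row is polynomial and hence passes to limits.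
\<close>

definition primitive_residual :: "state \<Rightarrow> state \<Rightarrow> state \<Rightarrow> real \<Rightarrow> real ^ 6" where
  "primitive_residual v a b w = vector
     [rho a + u1 v * rho b + rho v * u1 b,
      rho v * (u1 a + u1 v * u1 b) + p11 b + rho v * w / 2,
      rho v * (u2 a + u1 v * u2 b) + p12 b,
      p11 a + u1 v * p11 b + 3 * p11 v * u1 b,
      p12 a + u1 v * p12 b + 2 * p12 v * u1 b + p11 v * u2 b,
      p22 a + u1 v * p22 b + p22 v * u1 b + 2 * p12 v * u2 b]"

lemma differentiable_cons: "cons differentiable (at v)"
proof (rule differentiable_vec_componentwise)
  have nth: "(\<lambda>v :: state. v $ j) differentiable (at v)" for j
    by (rule bounded_linear_imp_differentiable[OF bounded_linear_vec_nth])
  have "\<forall>i. (\<lambda>v. cons v $ i) differentiable (at v)"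
    unfolding forall_6 cons_def E11_def E12_def E22_def divide_inverse vector_6
    by (intro conjI differentiable_mult differentiable_add differentiable_const nth)
  then show "(\<lambda>v. cons v $ i) differentiable (at v)" for i by blast
qed

lemma differentiable_flux: "flux differentiable (at v)"
proof (rule differentiable_vec_componentwise)
  have nth: "(\<lambda>v :: state. v $ j) differentiable (at v)" for j
    by (rule bounded_linear_imp_differentiable[OF bounded_linear_vec_nth])
  have "\<forall>i. (\<lambda>v. flux v $ i) differentiable (at v)"
    unfolding forall_6 flux_def E11_def E12_def E22_def divide_inverse vector_6 power2_eq_square
    by (intro conjI differentiable_mult differentiable_add differentiable_const nth)
  then show "(\<lambda>v. flux v $ i) differentiable (at v)" for i by blast
qed

text \<open>
  The passage from the conserved to the primitive variables: each row of the residual is a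
  combination, with coefficients polynomial in the velocities, of the rows of the balance law.
\<close>

lemma primitive_form:
  assumes f: "f differentiable (at z)"
    and balance: "dt (\<lambda>y. cons (f y)) z + dx (\<lambda>y. flux (f y)) z = source (f z) w"
  shows "primitive_residual (f z) (dt f z) (dx f z) w = 0"
proof -
  define v a b where "v = f z" and "a = dt f z" and "b = dx f z"
  have "(\<lambda>y. cons (f y)) differentiable (at z)" "(\<lambda>y. flux (f y)) differentiable (at z)"
    using differentiable_compose[OF differentiable_cons f]
      differentiable_compose[OF differentiable_flux f] by auto
  then have comp: "dt (\<lambda>y. cons (f y)) z $ i = dt (\<lambda>y. cons (f y) $ i) z"
    "dx (\<lambda>y. flux (f y)) z $ i = dx (\<lambda>y. flux (f y) $ i) z" for i
    by (simp_all add: dt_vec_nth dx_vec_nth)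
  have t [derivative_intros]: "((\<lambda>t. f (t, snd z) $ i) has_real_derivative a $ i) (at (fst z))"
    and x [derivative_intros]: "((\<lambda>x. f (fst z, x) $ i) has_real_derivative b $ i) (at (snd z))" for i
    using bounded_linear.has_vector_derivative[OF bounded_linear_vec_nth
        differentiable_has_vector_derivative_dt[OF f]]
      bounded_linear.has_vector_derivative[OF bounded_linear_vec_nth
        differentiable_has_vector_derivative_dx[OF f]]
    by (simp_all add: a_def b_def has_real_derivative_iff_has_vector_derivative)
  have dtI: "dt q z = d" if "((\<lambda>t. q (t, snd z)) has_real_derivative d) (at (fst z))" for q d
    using that unfolding dt_def has_real_derivative_iff_has_vector_derivative
    by (rule vector_derivative_at)
  have dxI: "dx q z = d" if "((\<lambda>x. q (fst z, x)) has_real_derivative d) (at (snd z))" for q d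
    using that unfolding dx_def has_real_derivative_iff_has_vector_derivative
    by (rule vector_derivative_at)
  have eq: "dt (\<lambda>y. cons (f y) $ i) z + dx (\<lambda>y. flux (f y) $ i) z = source v w $ i" for i
    using balance comp[of i] by (metis v_def vector_add_component)
  note defs = cons_def flux_def source_def E11_def E12_def E22_def vector_6
  have ct: "dt (\<lambda>y. cons (f y) $ 1) z = rho a"
    "dt (\<lambda>y. cons (f y) $ 2) z = rho a * u1 v + rho v * u1 a"
    "dt (\<lambda>y. cons (f y) $ 3) z = rho a * u2 v + rho v * u2 a"
    "dt (\<lambda>y. cons (f y) $ 4) z = (rho a * u1 v * u1 v + 2 * rho v * u1 v * u1 a + p11 a) / 2"
    "dt (\<lambda>y. cons (f y) $ 5) z
      = (rho a * u1 v * u2 v + rho v * u1 a * u2 v + rho v * u1 v * u2 a + p12 a) / 2"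
    "dt (\<lambda>y. cons (f y) $ 6) z = (rho a * u2 v * u2 v + 2 * rho v * u2 v * u2 a + p22 a) / 2"
    unfolding defs
    by (rule dtI; auto intro!: derivative_eq_intros simp: v_def algebra_simps)+
  have fx: "dx (\<lambda>y. flux (f y) $ 1) z = rho b * u1 v + rho v * u1 b"
    "dx (\<lambda>y. flux (f y) $ 2) z = rho b * (u1 v)\<^sup>2 + 2 * rho v * u1 v * u1 b + p11 b"
    "dx (\<lambda>y. flux (f y) $ 3) z
      = rho b * u1 v * u2 v + rho v * u1 b * u2 v + rho v * u1 v * u2 b + p12 b"
    "dx (\<lambda>y. flux (f y) $ 4) z
      = (rho b * (u1 v)^3 + 3 * rho v * (u1 v)\<^sup>2 * u1 b + 3 * (p11 b * u1 v + p11 v * u1 b)) / 2"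
    "dx (\<lambda>y. flux (f y) $ 5) z
      = (rho b * (u1 v)\<^sup>2 * u2 v + 2 * rho v * u1 v * u1 b * u2 v + rho v * (u1 v)\<^sup>2 * u2 b
         + 2 * (p12 b * u1 v + p12 v * u1 b) + p11 b * u2 v + p11 v * u2 b) / 2"
    "dx (\<lambda>y. flux (f y) $ 6) z
      = (rho b * u1 v * (u2 v)\<^sup>2 + rho v * u1 b * (u2 v)\<^sup>2 + 2 * rho v * u1 v * u2 v * u2 b
         + p22 b * u1 v + p22 v * u1 b + 2 * (p12 b * u2 v + p12 v * u2 b)) / 2"
    unfolding defs
    by (rule dxI; auto intro!: derivative_eq_intros
        simp: v_def field_simps power2_eq_square power3_eq_cube)+
  have half: "x + y = - c" if "x / 2 + y / 2 = - c / 2" for x y c :: real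
    using that by linarith
  have half0: "x + y = 0" if "x / 2 + y / 2 = 0" for x y :: real
    using that by linarith
  have e1: "rho a + (rho b * u1 v + rho v * u1 b) = 0"
    using eq[of 1] unfolding ct fx by (simp add: source_def)
  have e2: "2 * (rho a * u1 v + rho v * u1 a)
      + 2 * (rho b * (u1 v)\<^sup>2 + 2 * rho v * u1 v * u1 b + p11 b) = - (rho v * w)"
    using eq[of 2] unfolding ct fx by (simp add: source_def)
  have e3: "rho a * u2 v + rho v * u2 a
      + (rho b * u1 v * u2 v + rho v * u1 b * u2 v + rho v * u1 v * u2 b + p12 b) = 0"
    using eq[of 3] unfolding ct fx source_def vector_6 by linarith
  have e4: "(rho a * u1 v * u1 v + 2 * rho v * u1 v * u1 a + p11 a)
      + (rho b * (u1 v)^3 + 3 * rho v * (u1 v)\<^sup>2 * u1 b + 3 * (p11 b * u1 v + p11 v * u1 b))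
      = - (rho v * u1 v * w)"
    by (rule half) (use eq[of 4] in \<open>unfold ct fx source_def vector_6\<close>)
  have e5: "2 * (rho a * u1 v * u2 v + rho v * u1 a * u2 v + rho v * u1 v * u2 a + p12 a)
      + 2 * (rho b * (u1 v)\<^sup>2 * u2 v + 2 * rho v * u1 v * u1 b * u2 v + rho v * (u1 v)\<^sup>2 * u2 b
         + 2 * (p12 b * u1 v + p12 v * u1 b) + p11 b * u2 v + p11 v * u2 b)
      = - (rho v * u2 v * w)"
    using eq[of 5] unfolding ct fx source_def vector_6 by linarith
  have e6: "(rho a * u2 v * u2 v + 2 * rho v * u2 v * u2 a + p22 a)
      + (rho b * u1 v * (u2 v)\<^sup>2 + rho v * u1 b * (u2 v)\<^sup>2 + 2 * rho v * u1 v * u2 v * u2 b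
         + p22 b * u1 v + p22 v * u1 b + 2 * (p12 b * u2 v + p12 v * u2 b)) = 0"
    by (rule half0) (use eq[of 6] in \<open>unfold ct fx source_def vector_6\<close>)
  have r1: "rho a + u1 v * rho b + rho v * u1 b = 0"
    using e1 by (simp add: algebra_simps)
  have r2: "2 * rho v * (u1 a + u1 v * u1 b) + 2 * p11 b + rho v * w = 0"
    using e1 e2 by algebra
  have r3: "rho v * (u2 a + u1 v * u2 b) + p12 b = 0"
    using e1 e3 by algebra
  have r4: "p11 a + u1 v * p11 b + 3 * p11 v * u1 b = 0"
    using r1 r2 e4 by algebra
  have r5: "2 * (p12 a + u1 v * p12 b + 2 * p12 v * u1 b + p11 v * u2 b) = 0"
    using r1 r2 r3 e5 by algebra
  have r6: "p22 a + u1 v * p22 b + p22 v * u1 b + 2 * p12 v * u2 b = 0"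
    using r1 r3 e6 by algebra
  show ?thesis
    using r1 r2 r3 r4 r5 r6
    by (simp add: vec_eq_iff forall_6 primitive_residual_def flip: v_def a_def b_def)
qed

lemma primitive_residual_limit:
  assumes "F \<noteq> bot" and "(v \<longlongrightarrow> V) F" "(a \<longlongrightarrow> A) F" "(b \<longlongrightarrow> B) F" "(w \<longlongrightarrow> W) F"
    and "\<forall>\<^sub>F z in F. primitive_residual (v z) (a z) (b z) (w z) = 0"
  shows "primitive_residual V A B W = 0"
proof (rule tendsto_unique[OF \<open>F \<noteq> bot\<close>])
  have "\<forall>i. ((\<lambda>z. primitive_residual (v z) (a z) (b z) (w z) $ i) \<longlongrightarrow> primitive_residual V A B W $ i) F"
    unfolding forall_6 primitive_residual_def vector_6
    by (intro conjI tendsto_intros assms) auto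
  then show "((\<lambda>z. primitive_residual (v z) (a z) (b z) (w z)) \<longlongrightarrow> primitive_residual V A B W) F"
    by (simp add: vec_tendstoI)
  show "((\<lambda>z. primitive_residual (v z) (a z) (b z) (w z)) \<longlongrightarrow> 0) F"
    using assms(6) by (rule tendsto_eventually)
qed

section \<open>Limits and one-sided derivatives at the corner\<close>

text \<open>
  Limits at the corner are values of the total operator \<open>Lim\<close>; they are meaningful only because the
  region accumulates at the origin.
\<close>

lemma corner_not_bot:
  assumes c: "(c \<longlongrightarrow> 0) (at_right 0)" and A: "\<forall>\<^sub>F s :: real in at_right 0. (s, c s) \<in> A"
  shows "at (0, 0 :: real) within A \<noteq> bot"
proof
  assume bot: "at (0, 0 :: real) within A = bot"
  have "filterlim (\<lambda>s. (s, c s)) (at (0, 0) within A) (at_right 0)"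
    unfolding filterlim_at
  proof
    show "((\<lambda>s. (s, c s)) \<longlongrightarrow> (0, 0)) (at_right 0)" by (intro tendsto_Pair c tendsto_ident_at)
    have "\<forall>\<^sub>F s :: real in at_right 0. 0 < s" by (simp add: eventually_at_right_less)
    with A show "\<forall>\<^sub>F s in at_right 0. (s, c s) \<in> A \<and> (s, c s) \<noteq> (0, 0)"
      by eventually_elim auto
  qed
  then show False unfolding bot filterlim_def by (simp add: bot_unique filtermap_bot_iff)
qed

lemma at_within_atLeastLessThan_eq_at_right:
  fixes a b :: real
  assumes "a < b"
  shows "at a within {a..<b} = at_right a"
  by (rule at_within_nhd[of _ "{..<b}"]) (use assms in auto)

text \<open>
  This turns a relation holding along the shock for \<open>t > 0\<close> into one between the limiting states and
  one between their derivatives along the shock.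
\<close>

lemma vanishing_has_zero_one_sided_derivative:
  fixes F :: "real \<Rightarrow> real"
  assumes D: "(F has_real_derivative D) (at 0 within {0..<\<tau>})" and "0 < \<tau>"
    and zero: "\<And>t. 0 < t \<Longrightarrow> t < \<tau> \<Longrightarrow> F t = 0"
  shows "F 0 = 0" and "D = 0"
proof -
  note at = at_within_atLeastLessThan_eq_at_right[OF \<open>0 < \<tau>\<close>]
  have "(F \<longlongrightarrow> F 0) (at_right 0)"
    using DERIV_continuous[OF D] by (simp add: continuous_within at)
  moreover have "(F \<longlongrightarrow> 0) (at_right 0)"
    by (rule tendsto_eventually, rule eventually_at_rightI[of 0 \<tau>]) (use zero \<open>0 < \<tau>\<close> in auto)
  ultimately show F0: "F 0 = 0"
    by (intro tendsto_unique[of "at_right 0" F]) auto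
  have "((\<lambda>_. 0) has_real_derivative D) (at 0 within {0..<\<tau>})"
    by (rule has_field_derivative_transform_within[OF D zero_less_one])
      (use zero F0 \<open>0 < \<tau>\<close> in \<open>auto simp: less_le\<close>)
  then show "D = 0"
    by (rule has_field_derivative_unique[OF _ DERIV_const]) (simp add: at)
qed

section \<open>Derivatives of the shock relations\<close>

text \<open>
  The total derivative of \<open>F - \<sigma> U\<close> along a curve. The same formula serves both sides of
  the shock.
\<close>

lemma jump_flux_derivatives:
  fixes v :: "real \<Rightarrow> state"
  assumes v: "(v has_vector_derivative d) (at t within S)" and s: "(s has_real_derivative r) (at t within S)"
  shows "((\<lambda>t. flux (v t) $ 1 - s t * cons (v t) $ 1) has_real_derivative
      (u1 (v t) - s t) * rho d + rho (v t) * u1 d - rho (v t) * r) (at t within S)"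
    and "((\<lambda>t. flux (v t) $ 3 - s t * cons (v t) $ 3) has_real_derivative
      u2 (v t) * (u1 (v t) - s t) * rho d + rho (v t) * u2 (v t) * u1 d
       + rho (v t) * (u1 (v t) - s t) * u2 d + p12 d - rho (v t) * u2 (v t) * r) (at t within S)"
    and "((\<lambda>t. flux (v t) $ 5 - s t * cons (v t) $ 5) has_real_derivative
      1/2 * u1 (v t) * u2 (v t) * (u1 (v t) - s t) * rho d
       + (2 * E12 (v t) - 1/2 * rho (v t) * u2 (v t) * s t) * u1 d
       + (E11 (v t) - 1/2 * rho (v t) * u1 (v t) * s t) * u2 d
       + 1/2 * u2 (v t) * p11 d + (u1 (v t) - 1/2 * s t) * p12 d - E12 (v t) * r) (at t within S)"
    and "((\<lambda>t. flux (v t) $ 6 - s t * cons (v t) $ 6) has_real_derivative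
      1/2 * (u2 (v t))\<^sup>2 * (u1 (v t) - s t) * rho d + E22 (v t) * u1 d
       + (2 * E12 (v t) - rho (v t) * u2 (v t) * s t) * u2 d
       + u2 (v t) * p12 d + 1/2 * (u1 (v t) - s t) * p22 d - E22 (v t) * r) (at t within S)"
proof -
  have [derivative_intros]: "((\<lambda>t. v t $ i) has_real_derivative d $ i) (at t within S)" for i
    using bounded_linear.has_vector_derivative[OF bounded_linear_vec_nth v]
    by (simp add: has_real_derivative_iff_has_vector_derivative)
  note [derivative_intros] = s
  show "((\<lambda>t. flux (v t) $ 1 - s t * cons (v t) $ 1) has_real_derivative
      (u1 (v t) - s t) * rho d + rho (v t) * u1 d - rho (v t) * r) (at t within S)"
    unfolding cons_def flux_def E11_def E12_def E22_def vector_6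
    by (auto intro!: derivative_eq_intros simp: algebra_simps)
  show "((\<lambda>t. flux (v t) $ 3 - s t * cons (v t) $ 3) has_real_derivative
      u2 (v t) * (u1 (v t) - s t) * rho d + rho (v t) * u2 (v t) * u1 d
       + rho (v t) * (u1 (v t) - s t) * u2 d + p12 d - rho (v t) * u2 (v t) * r) (at t within S)"
    unfolding cons_def flux_def E11_def E12_def E22_def vector_6
    by (auto intro!: derivative_eq_intros simp: algebra_simps)
  show "((\<lambda>t. flux (v t) $ 5 - s t * cons (v t) $ 5) has_real_derivative
      1/2 * u1 (v t) * u2 (v t) * (u1 (v t) - s t) * rho d
       + (2 * E12 (v t) - 1/2 * rho (v t) * u2 (v t) * s t) * u1 d
       + (E11 (v t) - 1/2 * rho (v t) * u1 (v t) * s t) * u2 d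
       + 1/2 * u2 (v t) * p11 d + (u1 (v t) - 1/2 * s t) * p12 d - E12 (v t) * r) (at t within S)"
    unfolding cons_def flux_def E11_def E12_def E22_def vector_6
    by (auto intro!: derivative_eq_intros simp: field_simps power2_eq_square)
  show "((\<lambda>t. flux (v t) $ 6 - s t * cons (v t) $ 6) has_real_derivative
      1/2 * (u2 (v t))\<^sup>2 * (u1 (v t) - s t) * rho d + E22 (v t) * u1 d
       + (2 * E12 (v t) - rho (v t) * u2 (v t) * s t) * u2 d
       + u2 (v t) * p12 d + 1/2 * (u1 (v t) - s t) * p22 d - E22 (v t) * r) (at t within S)"
    unfolding cons_def flux_def E11_def E12_def E22_def vector_6
    by (auto intro!: derivative_eq_intros simp: field_simps power2_eq_square)
qed

section \<open>Corner limits of the solution\<close>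

context grp_nonsonic_6shock
begin

lemma front_has_derivative:
  assumes "a \<in> fronts P" "0 < s" "s < tmax P"
  shows "(a has_real_derivative speed P a s) (at s)"
proof -
  have at: "at s within {0..<tmax P} = at s"
    using assms by (intro at_within_open_subset[of _ "{0<..<tmax P}"]) auto
  have "a differentiable (at s)"
    using fronts_smooth[OF assms(1)] assms(2,3)
    by (auto simp: smooth_front_def differentiable_on_def simp flip: at)
  then show ?thesis
    unfolding speed_def at has_real_derivative_iff_has_vector_derivative
    by (simp add: vector_derivative_works)
qed

lemma at_right_0: "at 0 within {0..<tmax P} = at_right 0"
  using box(1) by (rule at_within_atLeastLessThan_eq_at_right)

lemma front_tendsto_0:
  assumes "a \<in> fronts P"
  shows "(a \<longlongrightarrow> 0) (at_right 0)"
proof -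
  have "a differentiable (at 0 within {0..<tmax P})"
    using fronts_smooth[OF assms] box by (auto simp: smooth_front_def differentiable_on_def)
  then have "(a \<longlongrightarrow> a 0) (at_right 0)"
    using differentiable_imp_continuous_within by (fastforce simp: continuous_within at_right_0)
  then show ?thesis using fronts_smooth[OF assms] by (simp add: smooth_front_def)
qed

lemma speed_tendsto:
  assumes "a \<in> fronts P"
  shows "(speed P a \<longlongrightarrow> speed P a 0) (at_right 0)"
  using fronts_smooth[OF assms] box
  by (auto simp: smooth_front_def continuous_on_def simp flip: at_right_0)

lemma w5_w6_fronts: "w5 P \<in> fronts P" "w6 P \<in> fronts P"
  by (simp_all add: fronts_def)

lemma corner_regions: "starR P \<in> regions P" "rightR P \<in> regions P"
  by (simp_all add: regions_def)

lemma sol_differentiable: "A \<in> regions P \<Longrightarrow> z \<in> A \<Longrightarrow> sol P differentiable (at z)"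
  using sol_C1 by (simp add: C1_on_def)

lemma eventually_below_tmax: "\<forall>\<^sub>F s in at_right 0. 0 < s \<and> s < tmax P"
  using box by (intro eventually_at_rightI[of 0 "tmax P"]) auto

lemma inside_starR:
  "\<forall>\<^sub>F s in at_right 0. \<forall>l. 0 < l \<and> l < 1 \<longrightarrow> (s, w6 P s + l * (w5 P s - w6 P s)) \<in> starR P"
  using eventually_below_tmax
proof eventually_elim
  case (elim s)
  show ?case
  proof (intro allI impI)
    fix l :: real assume l: "0 < l \<and> l < 1"
    have "w5 P s < w6 P s" using fronts_ordered elim by blast
    then have "0 < l * (w6 P s - w5 P s)" "0 < (1 - l) * (w6 P s - w5 P s)" using l by simp_all
    then show "(s, w6 P s + l * (w5 P s - w6 P s)) \<in> starR P"
      using elim by (simp add: starR_def between_def algebra_simps)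
  qed
qed

text \<open>
  To the right of the shock the slanted line of slope 1 is added; it stays inside the box for a short
  time because the shock starts at the origin.
\<close>

lemma inside_rightR:
  "\<forall>\<^sub>F s in at_right 0. \<forall>l. 0 < l \<and> l < 1 \<longrightarrow> (s, w6 P s + l * s) \<in> rightR P"
proof -
  have "((\<lambda>s. w6 P s + s) \<longlongrightarrow> 0 + 0) (at_right 0)"
    by (intro tendsto_intros front_tendsto_0 w5_w6_fronts)
  then have "\<forall>\<^sub>F s in at_right 0. w6 P s + s < xmax P"
    using box by (intro order_tendstoD(2)) auto
  then show ?thesis using eventually_below_tmax
  proof eventually_elim
    case (elim s)
    have "l * s \<le> s" "0 < l * s" if "0 < l \<and> l < 1" for l using that elim by simp_all
    with elim show ?case by (fastforce simp: rightR_def between_def)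
  qed
qed

lemma corners_not_bot:
  "at (0, 0) within starR P \<noteq> bot" "at (0, 0) within rightR P \<noteq> bot"
proof -
  have "((\<lambda>s. w6 P s + 1/2 * (w5 P s - w6 P s)) \<longlongrightarrow> 0 + 1/2 * (0 - 0)) (at_right 0)"
    by (intro tendsto_intros front_tendsto_0 w5_w6_fronts)
  moreover have "\<forall>\<^sub>F s in at_right 0. (s, w6 P s + 1/2 * (w5 P s - w6 P s)) \<in> starR P"
    using inside_starR by (rule eventually_mono) (drule spec[of _ "1/2"], simp)
  ultimately show "at (0, 0) within starR P \<noteq> bot"
    by (intro corner_not_bot[of "\<lambda>s. w6 P s + 1/2 * (w5 P s - w6 P s)"]) simp_all
  have "((\<lambda>s. w6 P s + 1/2 * s) \<longlongrightarrow> 0 + 1/2 * 0) (at_right 0)"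
    by (intro tendsto_intros front_tendsto_0 w5_w6_fronts)
  moreover have "\<forall>\<^sub>F s in at_right 0. (s, w6 P s + 1/2 * s) \<in> rightR P"
    using inside_rightR by (rule eventually_mono) (drule spec[of _ "1/2"], simp)
  ultimately show "at (0, 0) within rightR P \<noteq> bot"
    by (intro corner_not_bot[of "\<lambda>s. w6 P s + 1/2 * s"]) simp_all
qed

definition "dt_sR = Lim (at (0, 0) within starR P) (dt (sol P))"
definition "dx_sR = Lim (at (0, 0) within starR P) (dx (sol P))"
definition "dt_R = Lim (at (0, 0) within rightR P) (dt (sol P))"

lemma tendsto_Lim_if_origin_limit:
  assumes "has_origin_limit A f" "at (0, 0) within A \<noteq> bot"
  shows "(f \<longlongrightarrow> Lim (at (0, 0) within A) f) (at (0, 0) within A)"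
  using assms tendsto_Lim unfolding has_origin_limit_def by metis

lemma tendsto_starR:
  "(sol P \<longlongrightarrow> VsR P) (at (0, 0) within starR P)"
  "(dt (sol P) \<longlongrightarrow> dt_sR) (at (0, 0) within starR P)"
  "(dx (sol P) \<longlongrightarrow> dx_sR) (at (0, 0) within starR P)"
  unfolding dt_sR_def dx_sR_def
  by (intro tendsto_Lim_if_origin_limit limits_starR corners_not_bot)+

lemma tendsto_rightR:
  "(sol P \<longlongrightarrow> VR P) (at (0, 0) within rightR P)"
  "(dt (sol P) \<longlongrightarrow> dt_R) (at (0, 0) within rightR P)"
  "(dx (sol P) \<longlongrightarrow> VR' P) (at (0, 0) within rightR P)"
proof -
  note lim = tendsto_Lim_if_origin_limit[OF limits_right(1) corners_not_bot(2)]
    tendsto_Lim_if_origin_limit[OF limits_right(3) corners_not_bot(2)]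
  show "(dt (sol P) \<longlongrightarrow> dt_R) (at (0, 0) within rightR P)"
    unfolding dt_R_def by (intro tendsto_Lim_if_origin_limit limits_right corners_not_bot)
  have inside: "\<forall>\<^sub>F t in at_right 0. \<forall>y. x \<le> y \<and> y < xmax P \<longrightarrow> (t, y) \<in> rightR P" if "0 < x" for x
    using order_tendstoD(2)[OF front_tendsto_0[OF w5_w6_fronts(2)] that] eventually_below_tmax
    by eventually_elim (auto simp: rightR_def between_def)
  have "Lim (at (0, 0) within rightR P) (sol P) = VR P"
    by (rule corner_limits_from_initial_data(1)[OF _ lim box(2)])
      (blast intro: sol_differentiable corner_regions inside initial_right)+
  then show "(sol P \<longlongrightarrow> VR P) (at (0, 0) within rightR P)" using lim by simp
  have "Lim (at (0, 0) within rightR P) (dx (sol P)) = VR' P"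
    by (rule corner_limits_from_initial_data(2)[OF _ lim box(2)])
      (blast intro: sol_differentiable corner_regions inside initial_right)+
  then show "(dx (sol P) \<longlongrightarrow> VR' P) (at (0, 0) within rightR P)" using lim by simp
qed

lemma pot_deriv_tendsto:
  "((\<lambda>z. deriv (pot P) (snd z)) \<longlongrightarrow> Wx0 P) (at (0 :: real, 0) within A)"
proof -
  obtain D where D: "\<And>x. (pot P has_real_derivative D x) (at x)" "continuous_on UNIV D"
    using pot_C1 by (auto simp: C1_differentiable_on_def has_real_derivative_iff_has_vector_derivative)
  have "deriv (pot P) = D" using D(1) by (auto intro: DERIV_imp_deriv)
  then have "isCont (deriv (pot P)) 0" using D(2) by (simp add: continuous_on_eq_continuous_at)
  moreover have "((\<lambda>z :: real \<times> real. snd z) \<longlongrightarrow> snd (0 :: real, 0 :: real)) (at (0, 0) within A)"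
    by (intro tendsto_intros)
  ultimately show ?thesis by (auto intro: isCont_tendsto_compose)
qed

lemma eventually_in_corner: "\<forall>\<^sub>F z in at (0 :: real, 0 :: real) within A. z \<in> A"
  by (simp add: eventually_at_filter)

lemma primitive_corner:
  assumes A: "A \<in> regions P" and "at (0, 0) within A \<noteq> bot"
    and "(sol P \<longlongrightarrow> V) (at (0, 0) within A)" "(dt (sol P) \<longlongrightarrow> T) (at (0, 0) within A)"
      "(dx (sol P) \<longlongrightarrow> X) (at (0, 0) within A)"
  shows "primitive_residual V T X (Wx0 P) = 0"
proof (rule primitive_residual_limit[OF assms(2-5) pot_deriv_tendsto])
  show "\<forall>\<^sub>F z in at (0, 0) within A.
      primitive_residual (sol P z) (dt (sol P) z) (dx (sol P) z) (deriv (pot P) (snd z)) = 0"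
    using eventually_in_corner
    by eventually_elim (intro primitive_form sol_differentiable[OF A] balance_law[OF A])
qed

text \<open>
  Within the corner region differentiation commutes with taking components, so all limits of
  \<open>matd\<close> and \<open>par_t\<close> reduce to the two limits \<open>dt_sR\<close> and \<open>dx_sR\<close>.
\<close>

lemma matd_nth: "matd P (\<lambda>v. v $ i) = dt_sR $ i + u1 (VsR P) * dx_sR $ i"
  and par_t_nth: "par_t P (\<lambda>v. v $ i) = dt_sR $ i"
proof -
  let ?F = "at (0, 0) within starR P"
  have ev: "\<forall>\<^sub>F z in ?F. dt (sol P) z $ i = dt (\<lambda>y. sol P y $ i) z \<and>
      dx (sol P) z $ i = dx (\<lambda>y. sol P y $ i) z"
    using eventually_in_corner
    by eventually_elim
      (simp add: dt_vec_nth dx_vec_nth sol_differentiable[OF corner_regions(1)])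
  have t: "((\<lambda>z. dt (sol P) z $ i) \<longlongrightarrow> dt_sR $ i) ?F"
    and m: "((\<lambda>z. dt (sol P) z $ i + u1 (sol P z) * dx (sol P) z $ i)
      \<longlongrightarrow> dt_sR $ i + u1 (VsR P) * dx_sR $ i) ?F"
    by (intro tendsto_intros tendsto_starR)+
  have "((\<lambda>z. dt (\<lambda>y. sol P y $ i) z) \<longlongrightarrow> dt_sR $ i) ?F"
    by (rule Lim_transform_eventually[OF t]) (use ev in \<open>auto elim: eventually_mono\<close>)
  then show "par_t P (\<lambda>v. v $ i) = dt_sR $ i"
    unfolding par_t_def limR_def by (intro tendsto_Lim corners_not_bot) simp
  have "((\<lambda>z. dt (\<lambda>y. sol P y $ i) z + u1 (sol P z) * dx (\<lambda>y. sol P y $ i) z)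
      \<longlongrightarrow> dt_sR $ i + u1 (VsR P) * dx_sR $ i) ?F"
    by (rule Lim_transform_eventually[OF m]) (use ev in \<open>auto elim: eventually_mono\<close>)
  then show "matd P (\<lambda>v. v $ i) = dt_sR $ i + u1 (VsR P) * dx_sR $ i"
    unfolding matd_def limR_def by (intro tendsto_Lim corners_not_bot) simp
qed

section \<open>Traces on the shock\<close>

text \<open>
  At time 0 the one-sided limits in \<open>x\<close> say nothing about the state behind the shock; the corner
  limits take their place.
\<close>
definition "left_trace t = (if t = 0 then VsR P else traceL P (w6 P) t)"
definition "right_trace t = (if t = 0 then VR P else traceR P (w6 P) t)"

lemma left_trace_has_derivative:
  "(left_trace has_vector_derivative dt_sR + sigR P *\<^sub>R dx_sR) (at 0 within {0..<tmax P})"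
proof (rule one_sided_trace_has_vector_derivative[OF sol_differentiable[OF corner_regions(1)]
      tendsto_starR front_tendsto_0[OF w5_w6_fronts(2)] speed_tendsto[OF w5_w6_fronts(2)]])
  show "((\<lambda>s. w5 P s - w6 P s) \<longlongrightarrow> 0) (at_right 0)"
    using tendsto_diff[OF w5_w6_fronts[THEN front_tendsto_0]] by simp
  show "((\<lambda>s. speed P (w5 P) s - speed P (w6 P) s) \<longlongrightarrow> speed P (w5 P) 0 - speed P (w6 P) 0) (at_right 0)"
    by (intro tendsto_diff speed_tendsto w5_w6_fronts)
  fix s assume s: "0 < s" "s < tmax P"
  show "(w6 P has_real_derivative speed P (w6 P) s) (at s)"
    "((\<lambda>s. w5 P s - w6 P s) has_real_derivative speed P (w5 P) s - speed P (w6 P) s) (at s)"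
    by (intro DERIV_diff front_has_derivative w5_w6_fronts s)+
  have "((\<lambda>x. sol P (s, x)) \<longlongrightarrow> left_trace s) (at_left (w6 P s))"
    using traces[OF w5_w6_fronts(2) s] tendsto_Lim[OF trivial_limit_at_left_real] s
    unfolding has_traces_def left_trace_def traceL_def by auto
  moreover have "filterlim (\<lambda>l. w6 P s + l * (w5 P s - w6 P s)) (at_left (w6 P s)) (at_right 0)"
    unfolding filterlim_at
  proof
    have "((\<lambda>l. w6 P s + l * (w5 P s - w6 P s)) \<longlongrightarrow> w6 P s + 0 * (w5 P s - w6 P s)) (at_right 0)"
      by (intro tendsto_intros)
    then show "((\<lambda>l. w6 P s + l * (w5 P s - w6 P s)) \<longlongrightarrow> w6 P s) (at_right 0)" by simp
    have "w5 P s < w6 P s" using fronts_ordered s by blast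
    then show "\<forall>\<^sub>F l in at_right 0. w6 P s + l * (w5 P s - w6 P s) \<in> {..<w6 P s} \<and>
        w6 P s + l * (w5 P s - w6 P s) \<noteq> w6 P s"
      by (intro eventually_at_rightI[of 0 1]) (auto simp: mult_pos_neg)
  qed
  ultimately show "((\<lambda>l. sol P (s, w6 P s + l * (w5 P s - w6 P s))) \<longlongrightarrow> left_trace s) (at_right 0)"
    by (rule filterlim_compose)
qed (use inside_starR box in \<open>simp_all add: left_trace_def\<close>)

lemma right_trace_has_derivative:
  "(right_trace has_vector_derivative dt_R + sigR P *\<^sub>R VR' P) (at 0 within {0..<tmax P})"
proof (rule one_sided_trace_has_vector_derivative[OF sol_differentiable[OF corner_regions(2)]
      tendsto_rightR front_tendsto_0[OF w5_w6_fronts(2)] speed_tendsto[OF w5_w6_fronts(2)],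
      where h = "\<lambda>s. s" and h' = "\<lambda>_. 1" and \<kappa> = 1])
  fix s assume s: "0 < s" "s < tmax P"
  show "(w6 P has_real_derivative speed P (w6 P) s) (at s)"
    by (intro front_has_derivative w5_w6_fronts s)
  have "((\<lambda>x. sol P (s, x)) \<longlongrightarrow> right_trace s) (at_right (w6 P s))"
    using traces[OF w5_w6_fronts(2) s] tendsto_Lim[OF trivial_limit_at_right_real] s
    unfolding has_traces_def right_trace_def traceR_def by auto
  moreover have "filterlim (\<lambda>l. w6 P s + l * s) (at_right (w6 P s)) (at_right 0)"
    unfolding filterlim_at
  proof
    have "((\<lambda>l. w6 P s + l * s) \<longlongrightarrow> w6 P s + 0 * s) (at_right 0)"
      by (intro tendsto_intros)
    then show "((\<lambda>l. w6 P s + l * s) \<longlongrightarrow> w6 P s) (at_right 0)" by simp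
    show "\<forall>\<^sub>F l in at_right 0. w6 P s + l * s \<in> {w6 P s<..} \<and> w6 P s + l * s \<noteq> w6 P s"
      using s by (intro eventually_at_rightI[of 0 1]) auto
  qed
  ultimately show "((\<lambda>l. sol P (s, w6 P s + l * s)) \<longlongrightarrow> right_trace s) (at_right 0)"
    by (rule filterlim_compose)
qed (use inside_rightR box in \<open>auto simp: right_trace_def intro: tendsto_ident_at\<close>)

end

section \<open>Algebra of the shock relations\<close>

lemma primitive_residual_eq_0_iff:
  "primitive_residual v a b w = 0 \<longleftrightarrow>
     rho a + u1 v * rho b + rho v * u1 b = 0 \<and>
     rho v * (u1 a + u1 v * u1 b) + p11 b + rho v * w / 2 = 0 \<and>
     rho v * (u2 a + u1 v * u2 b) + p12 b = 0 \<and>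
     p11 a + u1 v * p11 b + 3 * p11 v * u1 b = 0 \<and>
     p12 a + u1 v * p12 b + 2 * p12 v * u1 b + p11 v * u2 b = 0 \<and>
     p22 a + u1 v * p22 b + p22 v * u1 b + 2 * p12 v * u2 b = 0"
  by (simp add: vec_eq_iff forall_6 primitive_residual_def)

text \<open>
  The derivative along \<open>\<partial>\<^sub>t + s \<partial>\<^sub>x\<close> is the material derivative plus \<open>s - u\<^sub>1\<close> times the space
  derivative, and the system expresses the former by the latter.
\<close>

lemma primitive_derivatives_along_line:
  assumes "primitive_residual v a b w = 0" and "rho v \<noteq> 0"
  shows "rho (a + s *\<^sub>R b) = (s - u1 v) * rho b - rho v * u1 b"
    and "u1 (a + s *\<^sub>R b) = (s - u1 v) * u1 b - p11 b / rho v - w / 2"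
    and "u2 (a + s *\<^sub>R b) = (s - u1 v) * u2 b - p12 b / rho v"
    and "p11 (a + s *\<^sub>R b) = (s - u1 v) * p11 b - 3 * p11 v * u1 b"
    and "p12 (a + s *\<^sub>R b) = (s - u1 v) * p12 b - 2 * p12 v * u1 b - p11 v * u2 b"
    and "p22 (a + s *\<^sub>R b) = (s - u1 v) * p22 b - p22 v * u1 b - 2 * p12 v * u2 b"
proof -
  note e = assms(1)[unfolded primitive_residual_eq_0_iff]
  have m1: "u1 a + u1 v * u1 b = - (p11 b / rho v) - w / 2"
    and m2: "u2 a + u1 v * u2 b = - (p12 b / rho v)"
    using e assms(2) by (simp_all add: field_simps)
  show "rho (a + s *\<^sub>R b) = (s - u1 v) * rho b - rho v * u1 b"
    "p11 (a + s *\<^sub>R b) = (s - u1 v) * p11 b - 3 * p11 v * u1 b"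
    "p12 (a + s *\<^sub>R b) = (s - u1 v) * p12 b - 2 * p12 v * u1 b - p11 v * u2 b"
    "p22 (a + s *\<^sub>R b) = (s - u1 v) * p22 b - p22 v * u1 b - 2 * p12 v * u2 b"
    using e by (simp_all add: left_diff_distrib)
  show "u1 (a + s *\<^sub>R b) = (s - u1 v) * u1 b - p11 b / rho v - w / 2"
    "u2 (a + s *\<^sub>R b) = (s - u1 v) * u2 b - p12 b / rho v"
    using m1 m2 by (simp_all add: left_diff_distrib)
qed

text \<open>
  Conversely, since \<open>p\<^sub>1\<^sub>1\<close> is nonzero, the space derivatives of all variables but the density and
  \<open>p\<^sub>2\<^sub>2\<close> can be recovered from material derivatives.
\<close>

lemma primitive_space_derivatives:
  assumes "primitive_residual v a b w = 0" and "p11 v \<noteq> 0"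
  shows "u1 b = - (p11 a + u1 v * p11 b) / (3 * p11 v)"
    and "u2 b = - (p12 a + u1 v * p12 b - 2 * p12 v / (3 * p11 v) * (p11 a + u1 v * p11 b)) / p11 v"
    and "p11 b = - rho v * (u1 a + u1 v * u1 b + w / 2)"
    and "p12 b = - rho v * (u2 a + u1 v * u2 b)"
proof -
  note e = assms(1)[unfolded primitive_residual_eq_0_iff]
  show u1: "u1 b = - (p11 a + u1 v * p11 b) / (3 * p11 v)"
    using e assms(2) by (simp add: field_simps)
  have "p11 a + u1 v * p11 b = - 3 * p11 v * u1 b" using e by simp
  then show "u2 b = - (p12 a + u1 v * p12 b - 2 * p12 v / (3 * p11 v) * (p11 a + u1 v * p11 b)) / p11 v"
    using e assms(2) by (simp add: field_simps)
  show "p11 b = - rho v * (u1 a + u1 v * u1 b + w / 2)" "p12 b = - rho v * (u2 a + u1 v * u2 b)"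
    using e by (simp_all add: algebra_simps)
qed

lemma shock_speed_has_derivative:
  fixes u p q r :: "real \<Rightarrow> real"
  assumes [derivative_intros]: "(u has_real_derivative u') (at t within S)"
      "(p has_real_derivative p') (at t within S)" "(q has_real_derivative q') (at t within S)"
      "(r has_real_derivative r') (at t within S)"
    and pos: "0 < p t" "0 < q t" "0 < r t"
  shows "((\<lambda>t. u t + sqrt ((2 * p t + q t) / r t)) has_real_derivative
     u' - sqrt (2 * p t + q t) / (2 * r t * sqrt (r t)) * r'
        + (q' / 2 + p') / sqrt (r t * (2 * p t + q t))) (at t within S)"
proof -
  \<comment> \<open>In terms of the square roots \<open>N\<close> and \<open>R\<close> both derivatives are rational expressions.\<close>
  define N where "N = sqrt (2 * p t + q t)"
  define R where "R = sqrt (r t)"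
  have NR: "0 < N" "0 < R" "2 * p t + q t = N\<^sup>2" "r t = R\<^sup>2" using pos by (simp_all add: N_def R_def)
  have "((\<lambda>t. u t + sqrt ((2 * p t + q t) / r t)) has_real_derivative
      u' + ((2 * p' + q') * r t - (2 * p t + q t) * r') / (r t * r t)
        * (inverse (sqrt ((2 * p t + q t) / r t)) / 2)) (at t within S)"
    using pos by (auto intro!: derivative_eq_intros simp: field_simps)
  also have "u' + ((2 * p' + q') * r t - (2 * p t + q t) * r') / (r t * r t)
        * (inverse (sqrt ((2 * p t + q t) / r t)) / 2)
     = u' - sqrt (2 * p t + q t) / (2 * r t * sqrt (r t)) * r'
        + (q' / 2 + p') / sqrt (r t * (2 * p t + q t))"
    using NR(1,2) unfolding NR(3,4)
    by (simp add: real_sqrt_mult real_sqrt_divide field_simps power2_eq_square)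
  finally show ?thesis .
qed

lemma shock_density_has_derivative:
  fixes p q r :: "real \<Rightarrow> real"
  assumes p: "(p has_real_derivative p') (at t within S)"
    and q: "(q has_real_derivative q') (at t within S)"
    and r: "(r has_real_derivative r') (at t within S)"
    and pos: "0 < p t" "0 < q t"
  shows "((\<lambda>t. r t * ((2 * p t + q t) / (p t + 2 * q t))) has_real_derivative
     3 * r t * q t / (p t + 2 * q t)\<^sup>2 * p' + - (3 * r t * p t) / (p t + 2 * q t)\<^sup>2 * q'
        + (2 * p t + q t) / (p t + 2 * q t) * r') (at t within S)"
proof -
  have nz: "p t + 2 * q t \<noteq> 0" using pos by simp
  have eq: "r t * (((2 * p' + q') * (p t + 2 * q t) - (2 * p t + q t) * (p' + 2 * q'))
        / ((p t + 2 * q t) * (p t + 2 * q t))) + r' * ((2 * p t + q t) / (p t + 2 * q t))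
     = 3 * r t * q t / (p t + 2 * q t)\<^sup>2 * p' + - (3 * r t * p t) / (p t + 2 * q t)\<^sup>2 * q'
        + (2 * p t + q t) / (p t + 2 * q t) * r'"
    using nz by (simp add: divide_simps power2_eq_square) algebra
  show ?thesis
    by (rule DERIV_cong[OF DERIV_mult'[OF r DERIV_divide[OF DERIV_add[OF DERIV_cmult[OF p] q]
            DERIV_add[OF p DERIV_cmult[OF q]] nz]] eq])
qed

text \<open>
  With \<open>e = E\<^sub>1\<^sub>1\<close> the left side is \<open>a\<^sub>3 b\<^sub>4 - a\<^sub>4 b\<^sub>3\<close>. For \<open>p, r > 0\<close> it vanishes exactly
  if the shock moves, relative to the gas, with the shear speed \<open>sqrt (p / r)\<close>.
\<close>

lemma shock_determinant:
  fixes r u s p e :: real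
  assumes "p \<noteq> 0" and e: "e = (r * u * u + p) / 2"
  defines "w \<equiv> u - s"
  shows "2 * r * w * ((e - 1/2 * r * u * s) * (w / p) + u - 1/2 * s)
     - (e + r * w\<^sup>2 - 1/2 * r * s\<^sup>2) * (1 + r * w\<^sup>2 / p)
     = - (r * w\<^sup>2 - p)\<^sup>2 / (2 * p)"
proof -
  have s: "s = u - w" by (simp add: w_def)
  show ?thesis
    using \<open>p \<noteq> 0\<close> unfolding s e by (simp add: divide_simps power2_eq_square) algebra
qed

lemma cramer_2:
  fixes a b c d x y k l :: real
  assumes "a * x + b * y = k" "c * x + d * y = l" "a * d - c * b \<noteq> 0"
  shows "x = (k * d - l * b) / (a * d - c * b)" and "y = (k * c - l * a) / (b * c - d * a)"
proof -
  have "x * (a * d - c * b) = k * d - l * b"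
    unfolding assms(1,2)[symmetric] by (simp add: algebra_simps)
  moreover have "y * (b * c - d * a) = k * c - l * a"
    unfolding assms(1,2)[symmetric] by (simp add: algebra_simps)
  moreover have "b * c - d * a \<noteq> 0" using assms(3) by (simp add: mult.commute)
  ultimately show "x = (k * d - l * b) / (a * d - c * b)" "y = (k * c - l * a) / (b * c - d * a)"
    using assms(3) by (simp_all add: eq_divide_eq)
qed

section \<open>The jump conditions differentiated along the shock\<close>

context grp_nonsonic_6shock
begin

abbreviation (input) "Ds_left \<equiv> dt_sR + sigR P *\<^sub>R dx_sR"
abbreviation (input) "Ds_right \<equiv> dt_R + sigR P *\<^sub>R VR' P"

lemma state_positive:
  "0 < rho (VR P)" "0 < p11 (VR P)" "0 < rho (VsR P)" "0 < p11 (VsR P)"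
  using data_admissible star_admissible by (auto simp: admissible_def)

lemma primitive_starR: "primitive_residual (VsR P) dt_sR dx_sR (Wx0 P) = 0"
  by (intro primitive_corner[OF corner_regions(1) corners_not_bot(1)] tendsto_starR)

lemma primitive_rightR: "primitive_residual (VR P) dt_R (VR' P) (Wx0 P) = 0"
  by (intro primitive_corner[OF corner_regions(2) corners_not_bot(2)] tendsto_rightR)

lemma Ds_right_components:
  "rho Ds_right = Ds_rho_R P" "u1 Ds_right = Ds_u1_R P" "u2 Ds_right = Ds_u2_R P"
  "p11 Ds_right = Ds_p11_R P" "p12 Ds_right = Ds_p12_R P" "p22 Ds_right = Ds_p22_R P"
  using primitive_derivatives_along_line[OF primitive_rightR, of "sigR P"] state_positive
  unfolding Ds_rho_R_def Ds_u1_R_def Ds_u2_R_def Ds_p11_R_def Ds_p12_R_def Ds_p22_R_def by simp_all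

lemma dx_sR_components:
  "u1 dx_sR = - matd P p11 / (3 * p11 (VsR P))"
  "u2 dx_sR = - (matd P p12 - 2 * p12 (VsR P) / (3 * p11 (VsR P)) * matd P p11) / p11 (VsR P)"
  "p11 dx_sR = - rho (VsR P) * (matd P u1 + Wx0 P / 2)"
  "p12 dx_sR = - rho (VsR P) * matd P u2"
  using primitive_space_derivatives[OF primitive_starR] state_positive unfolding matd_nth by simp_all

lemma Ds_left_components:
  "u1 Ds_left = Ds_u1_sR P" "u2 Ds_left = Ds_u2_sR P"
  "p11 Ds_left = Ds_p11_sR P" "p12 Ds_left = Ds_p12_sR P"
proof -
  \<comment> \<open>The material derivative moves with \<open>u\<^sub>1\<close> instead of the shock speed.\<close>
  have split: "Ds_left $ i = matd P (\<lambda>v. v $ i) + (sigR P - u1 (VsR P)) * dx_sR $ i" for i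
    by (simp add: matd_nth algebra_simps)
  show "u1 Ds_left = Ds_u1_sR P"
    unfolding Ds_u1_sR_def par_t_nth by (simp add: dx_sR_components(1))
  show "u2 Ds_left = Ds_u2_sR P" "p11 Ds_left = Ds_p11_sR P" "p12 Ds_left = Ds_p12_sR P"
    unfolding split Ds_u2_sR_def Ds_p11_sR_def Ds_p12_sR_def dx_sR_components(2-4)
    using state_positive by (simp_all add: field_simps)
qed

lemma trace_component_derivatives:
  "((\<lambda>t. left_trace t $ i) has_real_derivative Ds_left $ i) (at 0 within {0..<tmax P})"
  "((\<lambda>t. right_trace t $ i) has_real_derivative Ds_right $ i) (at 0 within {0..<tmax P})"
  using bounded_linear.has_vector_derivative[OF bounded_linear_vec_nth left_trace_has_derivative]
    bounded_linear.has_vector_derivative[OF bounded_linear_vec_nth right_trace_has_derivative]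
  by (simp_all add: has_real_derivative_iff_has_vector_derivative)

lemma traces_0: "left_trace 0 = VsR P" "right_trace 0 = VR P"
  by (simp_all add: left_trace_def right_trace_def)

lemma speed_has_derivative:
  "(speed P (w6 P) has_real_derivative Ds_sigma_R P) (at 0 within {0..<tmax P})"
proof (rule has_field_derivative_transform_within[OF _ zero_less_one])
  show "((\<lambda>t. u1 (right_trace t) + sqrt ((2 * p11 (left_trace t) + p11 (right_trace t)) / rho (right_trace t)))
      has_real_derivative Ds_sigma_R P) (at 0 within {0..<tmax P})"
    using shock_speed_has_derivative[OF trace_component_derivatives(2)[of 2]
        trace_component_derivatives(1)[of 4] trace_component_derivatives(2)[of 4]
        trace_component_derivatives(2)[of 1]]
    unfolding traces_0 Ds_right_components Ds_left_components Ds_sigma_R_def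
    using state_positive by simp
  fix t assume "t \<in> {0..<tmax P}"
  then show "u1 (right_trace t) + sqrt ((2 * p11 (left_trace t) + p11 (right_trace t)) / rho (right_trace t))
      = speed P (w6 P) t"
    using shock_speed[of t] shock_speed_origin
    by (cases "t = 0") (simp_all add: left_trace_def right_trace_def)
qed (use box in simp)

text \<open>
  Behind the shock the derivative of the density cannot be read off from material derivatives; it
  comes from differentiating the density relation along the shock.
\<close>

lemma shock_density_at_corner:
  shows "rho (VsR P) = rho (VR P) * ((2 * p11 (VsR P) + p11 (VR P)) / (p11 (VsR P) + 2 * p11 (VR P)))"
    and "rho Ds_left = Ds_rho_sR P"
proof -
  have "((\<lambda>t. rho (left_trace t) - rho (right_trace t) *
      ((2 * p11 (left_trace t) + p11 (right_trace t)) / (p11 (left_trace t) + 2 * p11 (right_trace t))))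
      has_real_derivative rho Ds_left - Ds_rho_sR P) (at 0 within {0..<tmax P})"
    using DERIV_diff[OF trace_component_derivatives(1)[of 1]
        shock_density_has_derivative[OF trace_component_derivatives(1)[of 4]
          trace_component_derivatives(2)[of 4] trace_component_derivatives(2)[of 1]]]
    unfolding traces_0 Ds_right_components Ds_left_components Ds_rho_sR_def H1R_def H2R_def H3R_def
    using state_positive by simp
  note z = vanishing_has_zero_one_sided_derivative[OF this box(1)]
  show "rho (VsR P) = rho (VR P) * ((2 * p11 (VsR P) + p11 (VR P)) / (p11 (VsR P) + 2 * p11 (VR P)))"
    using z(1) shock_density by (simp add: left_trace_def right_trace_def)
  show "rho Ds_left = Ds_rho_sR P"
    using z(2) shock_density by (simp add: left_trace_def right_trace_def)
qed

text \<open>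
  The Rankine--Hugoniot condition says that \<open>F - \<sigma> U\<close> is continuous across the shock for all
  \<open>t > 0\<close>, so values and one-sided derivatives at the origin agree as well.
\<close>

lemma jump_flux_at_corner:
  assumes "((\<lambda>t. flux (right_trace t) $ i - speed P (w6 P) t * cons (right_trace t) $ i)
      has_real_derivative DR) (at 0 within {0..<tmax P})"
    and "((\<lambda>t. flux (left_trace t) $ i - speed P (w6 P) t * cons (left_trace t) $ i)
      has_real_derivative DL) (at 0 within {0..<tmax P})"
  shows "flux (VR P) $ i - sigR P * cons (VR P) $ i = flux (VsR P) $ i - sigR P * cons (VsR P) $ i"
    and "DR = DL"
proof -
  have zero: "flux (right_trace t) $ i - speed P (w6 P) t * cons (right_trace t) $ i
      - (flux (left_trace t) $ i - speed P (w6 P) t * cons (left_trace t) $ i) = 0"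
    if "0 < t" "t < tmax P" for t
  proof -
    have "speed P (w6 P) t *\<^sub>R (cons (right_trace t) - cons (left_trace t))
        = flux (right_trace t) - flux (left_trace t)"
      using jump[OF w5_w6_fronts(2) that] that
      by (simp add: rankine_hugoniot_def left_trace_def right_trace_def)
    from arg_cong[OF this, of "\<lambda>v. v $ i"] show ?thesis by (simp add: algebra_simps)
  qed
  note z = vanishing_has_zero_one_sided_derivative[OF DERIV_diff[OF assms] box(1) zero]
  show "flux (VR P) $ i - sigR P * cons (VR P) $ i = flux (VsR P) $ i - sigR P * cons (VsR P) $ i"
    using z(1) by (simp add: traces_0)
  show "DR = DL" using z(2) by simp
qed

text \<open>
  The mass flux through the shock is the same on both sides; ahead of the shock it is given by the
  speed formula, and the density relation converts its square.
\<close>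

lemma momentum_flux_relative_to_shock:
  "rho (VsR P) * (u1 (VsR P) - sigR P)\<^sup>2 = p11 (VsR P) + 2 * p11 (VR P)"
proof -
  let ?N = "2 * p11 (VsR P) + p11 (VR P)"
  have mass: "rho (VR P) * (u1 (VR P) - sigR P) = rho (VsR P) * (u1 (VsR P) - sigR P)"
    using jump_flux_at_corner(1)[OF jump_flux_derivatives(1)[OF right_trace_has_derivative speed_has_derivative]
        jump_flux_derivatives(1)[OF left_trace_has_derivative speed_has_derivative]]
    by (simp add: flux_def cons_def algebra_simps)
  have "rho (VR P) * (u1 (VR P) - sigR P)\<^sup>2 = ?N"
    unfolding shock_speed_origin using state_positive by simp
  then have "(rho (VR P) * (u1 (VR P) - sigR P))\<^sup>2 = rho (VR P) * ?N"
    by algebra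
  then have "rho (VsR P) * (rho (VsR P) * (u1 (VsR P) - sigR P)\<^sup>2) = rho (VR P) * ?N"
    unfolding mass by (simp add: power2_eq_square algebra_simps)
  also have "\<dots> = rho (VsR P) * (p11 (VsR P) + 2 * p11 (VR P))"
    unfolding shock_density_at_corner(1) using state_positive by (simp add: add_pos_pos less_imp_neq)
  finally show ?thesis using state_positive by simp
qed

text \<open>
  The momentum flux \<open>\<rho> (u\<^sub>1 - \<sigma>)\<^sup>2 = p\<^sub>1\<^sub>1 + 2 p\<^sub>1\<^sub>1\<^sub>,\<^sub>R\<close> strictly exceeds \<open>p\<^sub>1\<^sub>1\<close>: the shock outruns the
  shear wave behind it, and the factor \<open>\<rho> (u\<^sub>1 - \<sigma>)\<^sup>2 - p\<^sub>1\<^sub>1\<close> of the determinant is positive.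
\<close>

lemma det_nonzero: "a3R P * b4R P - a4R P * b3R P \<noteq> 0"
proof -
  have "a3R P * b4R P - a4R P * b3R P
      = - (rho (VsR P) * (u1 (VsR P) - sigR P)\<^sup>2 - p11 (VsR P))\<^sup>2 / (2 * p11 (VsR P))"
    unfolding a3R_def b4R_def a4R_def b3R_def
    using state_positive by (intro shock_determinant) (simp_all add: E11_def)
  then show ?thesis unfolding momentum_flux_relative_to_shock using state_positive by simp
qed

text \<open>
  The differentiated jump conditions for \<open>\<rho> u\<^sub>2\<close> and \<open>E\<^sub>1\<^sub>2\<close>. Behind the shock the derivatives of
  \<open>u\<^sub>2\<close> and \<open>p\<^sub>1\<^sub>2\<close> along the shock are combinations of the two unknown material derivatives.
\<close>

lemma linear_system:
  "a3R P * matd P u2 + b3R P * matd P p12 = d3R P"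
  "a4R P * matd P u2 + b4R P * matd P p12 = d4R P"
proof -
  note right = right_trace_has_derivative and left = left_trace_has_derivative and s = speed_has_derivative
  have p: "p11 (VsR P) \<noteq> 0" using state_positive by simp
  have Gam: "Ds_Gam_m2_R P = u2 (VsR P) * (u1 (VsR P) - sigR P) * Ds_rho_sR P
      + rho (VsR P) * u2 (VsR P) * Ds_u1_sR P
      + rho (VsR P) * (u1 (VsR P) - sigR P) * Ds_u2_sR P + Ds_p12_sR P
      - rho (VsR P) * u2 (VsR P) * Ds_sigma_R P"
    using jump_flux_at_corner(2)[OF jump_flux_derivatives(2)[OF right s] jump_flux_derivatives(2)[OF left s]]
    unfolding traces_0 Ds_right_components Ds_left_components shock_density_at_corner(2) Ds_Gam_m2_R_def .
  show "a3R P * matd P u2 + b3R P * matd P p12 = d3R P"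
    unfolding a3R_def b3R_def d3R_def Gam Ds_u2_sR_def Ds_p12_sR_def
    using p by (simp add: divide_simps power2_eq_square) algebra
  have Gam: "Ds_Gam_E12_R P = 1/2 * u1 (VsR P) * u2 (VsR P) * (u1 (VsR P) - sigR P) * Ds_rho_sR P
      + (2 * E12 (VsR P) - 1/2 * rho (VsR P) * u2 (VsR P) * sigR P) * Ds_u1_sR P
      + (E11 (VsR P) - 1/2 * rho (VsR P) * u1 (VsR P) * sigR P) * Ds_u2_sR P
      + 1/2 * u2 (VsR P) * Ds_p11_sR P + (u1 (VsR P) - 1/2 * sigR P) * Ds_p12_sR P
      - E12 (VsR P) * Ds_sigma_R P"
    using jump_flux_at_corner(2)[OF jump_flux_derivatives(3)[OF right s] jump_flux_derivatives(3)[OF left s]]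
    unfolding traces_0 Ds_right_components Ds_left_components shock_density_at_corner(2) Ds_Gam_E12_R_def .
  show "a4R P * matd P u2 + b4R P * matd P p12 = d4R P"
    unfolding a4R_def b4R_def d4R_def Gam Ds_u2_sR_def Ds_p12_sR_def
    using p by (simp add: divide_simps power2_eq_square) algebra
qed

lemma time_derivatives:
  "par_t P u2 = matd P u2 + u1 (VsR P) / p11 (VsR P) *
     (matd P p12 - 2 * p12 (VsR P) / (3 * p11 (VsR P)) * matd P p11)"
  "par_t P p12 = matd P p12 + rho (VsR P) * u1 (VsR P) * matd P u2"
proof -
  have par_t: "par_t P (\<lambda>v. v $ i) = matd P (\<lambda>v. v $ i) - u1 (VsR P) * dx_sR $ i" for i
    by (simp add: matd_nth par_t_nth)
  show "par_t P u2 = matd P u2 + u1 (VsR P) / p11 (VsR P) *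
     (matd P p12 - 2 * p12 (VsR P) / (3 * p11 (VsR P)) * matd P p11)"
    "par_t P p12 = matd P p12 + rho (VsR P) * u1 (VsR P) * matd P u2"
    unfolding par_t dx_sR_components(2,4) using state_positive by (simp_all add: field_simps)
qed

text \<open>
  The jump condition for \<open>E\<^sub>2\<^sub>2\<close> determines the derivative of \<open>p\<^sub>2\<^sub>2\<close> along the shock. It contains the
  space derivative of \<open>p\<^sub>2\<^sub>2\<close>, which the evolution equation gives only multiplied by \<open>u\<^sub>1\<close>; hence the
  factor \<open>u\<^sub>1\<close> in front of \<open>ft_p22\<close>.
\<close>

lemma p22_equation: "g_p22 P * par_t P p22 = f_p22 P"
proof -
  note right = right_trace_has_derivative and left = left_trace_has_derivative and s = speed_has_derivative
  define w where "w = u1 (VsR P) - sigR P"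
  have p: "p11 (VsR P) \<noteq> 0" using state_positive by simp
  have "ft_p22 P = 1/2 * w * p22 Ds_left"
    using jump_flux_at_corner(2)[OF jump_flux_derivatives(4)[OF right s] jump_flux_derivatives(4)[OF left s]]
    unfolding traces_0 Ds_right_components Ds_left_components shock_density_at_corner(2) ft_p22_def
      Ds_Gam_E22_R_def w_def by linarith
  moreover have "u1 (VsR P) * p22 Ds_left
      = w * p22 dt_sR - sigR P * (p22 (VsR P) * u1 dx_sR + 2 * p12 (VsR P) * u2 dx_sR)"
    using primitive_starR unfolding primitive_residual_eq_0_iff w_def vector_add_component
      vector_scaleR_component real_scaleR_def by algebra
  ultimately have "u1 (VsR P) * ft_p22 P = 1/2 * w * (w * p22 dt_sR
      - sigR P * (p22 (VsR P) * u1 dx_sR + 2 * p12 (VsR P) * u2 dx_sR))"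
    by algebra
  then show ?thesis
    unfolding g_p22_def f_p22_def par_t_nth dx_sR_components w_def[symmetric]
    using p by (simp add: field_simps power2_eq_square)
qed

end

theorem theorem5p14:
  fixes P :: grp
  assumes "grp_nonsonic_6shock P"
  shows "a3R P * b4R P - a4R P * b3R P \<noteq> 0
    \<and> matd P u2 = (d3R P * b4R P - d4R P * b3R P) / (a3R P * b4R P - a4R P * b3R P)
    \<and> matd P p12 = (d3R P * a4R P - d4R P * a3R P) / (b3R P * a4R P - b4R P * a3R P)
    \<and> par_t P u2 = matd P u2 + u1 (VsR P) / p11 (VsR P) *
        (matd P p12 - 2 * p12 (VsR P) / (3 * p11 (VsR P)) * matd P p11)
    \<and> par_t P p12 = matd P p12 + rho (VsR P) * u1 (VsR P) * matd P u2
    \<and> g_p22 P * par_t P p22 = f_p22 P"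
proof -
  interpret grp_nonsonic_6shock P by fact
  show ?thesis
    using det_nonzero cramer_2[OF linear_system det_nonzero] time_derivatives p22_equation by blast
qed

end
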